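(* Assume $$\begin{cases}2\alpha+\gamma>\tfrac32&\text{if }\alpha\le1,\\2\alpha+\gamma>1&\text{if }\alpha>1.\end{cases}$$ Then the system $\{\mu_n^{-1/2}\phi_n\}_{n=1}^\infty$ is quadratically close to $\{\mu_n^{-1/2}\psi_n\}_{n=1}^\infty$ in the $V$-norm: $$\sum_{n=1}^\infty\big\|\mu_n^{-1/2}A^{1/2}\psi_n-\mu_n^{-1/2}A^{1/2}\phi_n\big\|^2<\infty.$$
   Context: $H$ is a separable infinite-dimensional complex Hilbert space with inner product $(\cdot,\cdot)$ and norm $\|\cdot\|$. $a$ is a closed, densely defined, Hermitian, positive-definite sesquilinear form with domain $V\subset H$, and $A$ is the associated self-adjoint operator: $V=D(A^{1/2})$, $a(u,v)=(A^{1/2}u,A^{1/2}v)$, $\|u\|_V=\|A^{1/2}u\|$. $A$ has compact resolvent, with eigenvalues $0<\mu_1\le\mu_2\le\dots$ (with multiplicity) and an orthonormal basis of eigenvectors $\psi_k$ of $H$. $b$ is a sesquilinear form on $V$ (continuous in the $V$-norm, hence determined by the values $b(\psi_m,\psi_n)$). Standing assumptions: there are $\gamma>0$, $\kappa>0$, $N_0>0$ with $\mu_{k+1}-\mu_k\ge\kappa k^{\gamma-1}$ for all $k\ge N_0$; and there are $\alpha\in\mathbb R$ with $2\alpha+\gamma>1$ and $M_b>0$ with $|b(\psi_m,\psi_n)|\le M_bm^{-\alpha}n^{-\alpha}$ for all $m,n\in\mathbb N$. Then $t=a+b$ is a closed sectorial form on $V$ and $T$ denotes the associated m-sectorial operator;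 $T$ has compact resolvent. For all sufficiently large $n$, $n>N$, $T$ has exactly one eigenvalue $\lambda_n$ inside the positively oriented contour $\Gamma_n=\partial\Pi_n$, $\Pi_n=\{z\in\mathbb C:\mu_n-\frac\kappa2(n-1)^{\gamma-1}<\operatorname{Re}z<\mu_n+\frac\kappa2n^{\gamma-1},\ |\operatorname{Im}z|<\frac\kappa2n^{\gamma-1}\}$; it is algebraically simple, and $\phi_n=\frac1{2\pi i}\int_{\Gamma_n}(z-T)^{-1}\psi_n\,dz$ is a corresponding eigenvector. For $n\le N$ the $\phi_n$ are root vectors (generalized eigenvectors) forming a basis of the direct sum of the root subspaces of $T$ for the remaining eigenvalues. *)

theory Defs
  imports "HOL-Analysis.Analysis"
begin

section \<open>Complex Hilbert spaces\<close>

class complex_vector = real_vector +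
  fixes scaleC :: "complex \<Rightarrow> 'a \<Rightarrow> 'a"  (infixr \<open>*\<^sub>C\<close> 75)
  assumes scaleC_add_right: "c *\<^sub>C (x + y) = c *\<^sub>C x + c *\<^sub>C y"
    and scaleC_add_left: "(c + d) *\<^sub>C x = c *\<^sub>C x + d *\<^sub>C x"
    and scaleC_scaleC: "c *\<^sub>C d *\<^sub>C x = (c * d) *\<^sub>C x"
    and scaleC_one: "1 *\<^sub>C x = x"
    and scaleR_scaleC: "r *\<^sub>R x = complex_of_real r *\<^sub>C x"

global_interpretation complex_vector:
  vector_space "scaleC :: complex \<Rightarrow> 'a \<Rightarrow> 'a::complex_vector"
  by standard
    (simp_all add: scaleC_add_right scaleC_add_left scaleC_scaleC scaleC_one)

text \<open>Inner products and sesquilinear forms are linear in the first argument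
  and antilinear in the second one.\<close>

class complex_inner = complex_vector + real_normed_vector +
  fixes cinner :: "'a \<Rightarrow> 'a \<Rightarrow> complex"
  assumes cinner_add_left: "cinner (x + y) z = cinner x z + cinner y z"
    and cinner_scaleC_left: "cinner (c *\<^sub>C x) y = c * cinner x y"
    and cinner_commute: "cinner x y = cnj (cinner y x)"
    and cinner_same: "cinner x x = complex_of_real ((norm x)\<^sup>2)"

class chilbert_space = complex_inner + banach

text \<open>Families indexed by the positive integers are functions on \<open>nat\<close> whose value
  at \<open>0\<close> is irrelevant.\<close>

definition orthonormal_basis :: "(nat \<Rightarrow> 'h::chilbert_space) \<Rightarrow> bool" where
  "orthonormal_basis \<psi> \<longleftrightarrow>
     (\<forall>m\<ge>1. \<forall>n\<ge>1. cinner (\<psi> m) (\<psi> n) = (if m = n then 1 else 0)) \<and>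
     closure (complex_vector.span (\<psi> ` {1..})) = UNIV"


section \<open>Unbounded operators\<close>

text \<open>An operator \<open>T\<close> is represented by its graph, so that \<^term>\<open>Domain T\<close> is its domain,
  \<^term>\<open>(u, w) \<in> T\<close> means \<open>T u = w\<close>, and relational composition and powers are
  composition and powers of operators with their natural domains.\<close>

definition op_app :: "('h \<times> 'h) set \<Rightarrow> 'h \<Rightarrow> 'h" where
  "op_app T u = (THE w. (u, w) \<in> T)"

definition adjoint_op :: "('h::chilbert_space \<times> 'h) set \<Rightarrow> ('h \<times> 'h) set" where
  "adjoint_op T = {(v, w). \<forall>(u, y)\<in>T. cinner y v = cinner u w}"

definition self_adjoint :: "('h::chilbert_space \<times> 'h) set \<Rightarrow> bool" where
  "self_adjoint T \<longleftrightarrow> closure (Domain T) = UNIV \<and> adjoint_op T = T"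

definition is_sqrt_op :: "('h::chilbert_space \<times> 'h) set \<Rightarrow> ('h \<times> 'h) set \<Rightarrow> bool" where
  "is_sqrt_op S A \<longleftrightarrow>
     self_adjoint S \<and> (\<forall>(u, w)\<in>S. 0 \<le> Re (cinner w u)) \<and> S O S = A"

text \<open>\<open>(z - T)\<inverse> y\<close> is the \<open>u\<close> with \<open>z u - T u = y\<close>, that is, \<open>T u = z u - y\<close>.\<close>

definition resolvent :: "('h::chilbert_space \<times> 'h) set \<Rightarrow> complex \<Rightarrow> 'h \<Rightarrow> 'h" where
  "resolvent T z y = (THE u. (u, z *\<^sub>C u - y) \<in> T)"

definition resolvent_set :: "('h::chilbert_space \<times> 'h) set \<Rightarrow> complex set" where
  "resolvent_set T =
     {z. (\<forall>y. \<exists>!u. (u, z *\<^sub>C u - y) \<in> T) \<and> bounded_linear (resolvent T z)}"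

definition has_compact_resolvent :: "('h::chilbert_space \<times> 'h) set \<Rightarrow> bool" where
  "has_compact_resolvent T \<longleftrightarrow>
     (\<exists>z\<in>resolvent_set T. compact (closure (resolvent T z ` cball 0 1)))"

definition is_eigenvalue :: "('h::chilbert_space \<times> 'h) set \<Rightarrow> complex \<Rightarrow> bool" where
  "is_eigenvalue T z \<longleftrightarrow> (\<exists>u. u \<noteq> 0 \<and> (u, z *\<^sub>C u) \<in> T)"

definition shift_op :: "('h::chilbert_space \<times> 'h) set \<Rightarrow> complex \<Rightarrow> ('h \<times> 'h) set" where
  "shift_op T z = {(u, w - z *\<^sub>C u) | u w. (u, w) \<in> T}"

definition root_subspace :: "('h::chilbert_space \<times> 'h) set \<Rightarrow> complex \<Rightarrow> 'h set" where
  "root_subspace T z = {u. \<exists>k::nat. (u, 0) \<in> shift_op T z ^^ k}"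

text \<open>Since the dimension of an infinite-dimensional space is \<open>0\<close> here, the value \<open>1\<close>
  really means one-dimensional.\<close>

definition algebraically_simple :: "('h::chilbert_space \<times> 'h) set \<Rightarrow> complex \<Rightarrow> bool" where
  "algebraically_simple T z \<longleftrightarrow> complex_vector.dim (root_subspace T z) = 1"


section \<open>Sesquilinear forms\<close>

text \<open>A form is a total function of which only the values on the domain \<open>V\<close> matter.\<close>

definition sesquilinear_on ::
    "'h::chilbert_space set \<Rightarrow> ('h \<Rightarrow> 'h \<Rightarrow> complex) \<Rightarrow> bool" where
  "sesquilinear_on V t \<longleftrightarrow> complex_vector.subspace V \<and>
     (\<forall>u\<in>V. \<forall>v\<in>V. \<forall>w\<in>V. t (u + v) w = t u w + t v w \<and> t w (u + v) = t w u + t w v) \<and>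
     (\<forall>c. \<forall>u\<in>V. \<forall>v\<in>V. t (c *\<^sub>C u) v = c * t u v \<and> t u (c *\<^sub>C v) = cnj c * t u v)"

definition hermitian_on :: "'h set \<Rightarrow> ('h \<Rightarrow> 'h \<Rightarrow> complex) \<Rightarrow> bool" where
  "hermitian_on V t \<longleftrightarrow> (\<forall>u\<in>V. \<forall>v\<in>V. t u v = cnj (t v u))"

definition positive_definite_on ::
    "'h::chilbert_space set \<Rightarrow> ('h \<Rightarrow> 'h \<Rightarrow> complex) \<Rightarrow> bool" where
  "positive_definite_on V t \<longleftrightarrow> (\<forall>u\<in>V. u \<noteq> 0 \<longrightarrow> Im (t u u) = 0 \<and> 0 < Re (t u u))"

definition closed_form ::
    "'h::chilbert_space set \<Rightarrow> ('h \<Rightarrow> 'h \<Rightarrow> complex) \<Rightarrow> bool" where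
  "closed_form V t \<longleftrightarrow> (\<forall>x u. (\<forall>i::nat. x i \<in> V) \<longrightarrow> x \<longlonglongrightarrow> u \<longrightarrow>
     (\<forall>\<epsilon>>0. \<exists>M. \<forall>i\<ge>M. \<forall>j\<ge>M. cmod (t (x i - x j) (x i - x j)) < \<epsilon>) \<longrightarrow>
     u \<in> V \<and> (\<lambda>i. t (x i - u) (x i - u)) \<longlonglongrightarrow> 0)"

text \<open>The operator associated with a form \<open>t\<close> by the first representation theorem:
  \<open>u \<in> V\<close> belongs to its domain, with image \<open>w\<close>, if \<open>t(u,v) = (w,v)\<close> for all \<open>v \<in> V\<close>.\<close>

definition form_op ::
    "'h::chilbert_space set \<Rightarrow> ('h \<Rightarrow> 'h \<Rightarrow> complex) \<Rightarrow> ('h \<times> 'h) set" where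
  "form_op V t = {(u, w). u \<in> V \<and> (\<forall>v\<in>V. t u v = cinner w v)}"


section \<open>Contours\<close>

text \<open>The Hilbert-space-valued analogue of the library's complex-valued contour integral.
  The corners of a path are negligible.\<close>

definition vcontour_integral ::
    "(real \<Rightarrow> complex) \<Rightarrow> (complex \<Rightarrow> 'h::chilbert_space) \<Rightarrow> 'h" where
  "vcontour_integral g f =
     integral {0..1} (\<lambda>s. vector_derivative g (at s within {0..1}) *\<^sub>C f (g s))"

definition Pi_box :: "(nat \<Rightarrow> real) \<Rightarrow> real \<Rightarrow> real \<Rightarrow> nat \<Rightarrow> complex set" where
  "Pi_box \<mu> \<kappa> \<gamma> n = {z.
     \<mu> n - \<kappa> / 2 * real (n - 1) powr (\<gamma> - 1) < Re z \<and>
     Re z < \<mu> n + \<kappa> / 2 * real n powr (\<gamma> - 1) \<and>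
     \<bar>Im z\<bar> < \<kappa> / 2 * real n powr (\<gamma> - 1)}"

definition Gamma_path :: "(nat \<Rightarrow> real) \<Rightarrow> real \<Rightarrow> real \<Rightarrow> nat \<Rightarrow> real \<Rightarrow> complex" where
  "Gamma_path \<mu> \<kappa> \<gamma> n = rectpath
     (Complex (\<mu> n - \<kappa> / 2 * real (n - 1) powr (\<gamma> - 1)) (- (\<kappa> / 2 * real n powr (\<gamma> - 1))))
     (Complex (\<mu> n + \<kappa> / 2 * real n powr (\<gamma> - 1)) (\<kappa> / 2 * real n powr (\<gamma> - 1)))"

definition Riesz_vector ::
    "('h::chilbert_space \<times> 'h) set \<Rightarrow> (real \<Rightarrow> complex) \<Rightarrow> 'h \<Rightarrow> 'h" where
  "Riesz_vector T g x =
     (1 / (2 * complex_of_real pi * \<i>)) *\<^sub>C vcontour_integral g (\<lambda>z. resolvent T z x)"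

text \<open>The eigenvalues of \<open>T\<close> not lying in any of the boxes with index \<open>n > N\<close>.\<close>

definition remaining_eigenvalues ::
    "('h::chilbert_space \<times> 'h) set \<Rightarrow> (nat \<Rightarrow> complex set) \<Rightarrow> nat \<Rightarrow> complex set" where
  "remaining_eigenvalues T P N = {z. is_eigenvalue T z \<and> (\<forall>n>N. z \<notin> P n)}"

end

theory Submission
  imports Defs "HOL-Complex_Analysis.Winding_Numbers"
begin

text \<open>For \<open>z\<close> on the contour \<open>\<Gamma>\<^sub>n\<close> let \<open>u = (z - T)\<inverse> \<psi>\<^sub>n\<close> have coefficients \<open>u\<^sub>k = (u, \<psi>\<^sub>k)\<close>. Testing the
  equation \<open>(z - T) u = \<psi>\<^sub>n\<close> with \<open>\<psi>\<^sub>m\<close> gives \<open>(z - \<mu>\<^sub>m) u\<^sub>m = \<delta>\<^sub>m\<^sub>n + b(u, \<psi>\<^sub>m)\<close>, and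
  \<open>\<bar>b(u, \<psi>\<^sub>m)\<bar> \<le> M m\<^sup>-\<^sup>\<alpha> s\<close> with the single number \<open>s = \<Sum> \<bar>u\<^sub>k\<bar> k\<^sup>-\<^sup>\<alpha>\<close>. Substituting this back bounds \<open>s\<close>
  by \<open>n\<^sup>-\<^sup>\<alpha> / \<bar>z - \<mu>\<^sub>n\<bar> + M \<tau> s\<close>, where \<open>\<tau> = \<Sum> k\<^sup>-\<^sup>2\<^sup>\<alpha> / \<bar>z - \<mu>\<^sub>k\<bar>\<close> tends to \<open>0\<close> as \<open>n\<close> grows, so that
  \<open>s \<le> 2 n\<^sup>-\<^sup>\<alpha> / \<bar>z - \<mu>\<^sub>n\<bar>\<close>. Integrating over \<open>\<Gamma>\<^sub>n\<close>, the coefficients \<open>x\<^sub>m\<close> of \<open>\<phi>\<^sub>n\<close> satisfy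
  \<open>\<bar>x\<^sub>n - 1\<bar> \<le> K n\<^sup>1\<^sup>-\<^sup>2\<^sup>\<alpha>\<^sup>-\<^sup>\<gamma>\<close> and \<open>\<bar>x\<^sub>m\<bar> \<le> K m\<^sup>-\<^sup>\<alpha> n\<^sup>-\<^sup>\<alpha> / \<bar>\<mu>\<^sub>m - \<mu>\<^sub>n\<bar>\<close> for \<open>m \<noteq> n\<close>. The sum in question is
  \<open>\<Sum>\<^sub>n \<Sum>\<^sub>m (\<mu>\<^sub>m / \<mu>\<^sub>n) \<bar>x\<^sub>m - \<delta>\<^sub>m\<^sub>n\<bar>\<^sup>2\<close>, which converges because \<open>2\<alpha> + \<gamma> > 3/2\<close>; this also holds when \<open>\<alpha> > 1\<close>,
  since \<open>\<gamma> > 0\<close>.\<close>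

section \<open>Orthonormal bases\<close>

lemma cinner_add_right:
  "cinner (x::'h::complex_inner) (y + z) = cinner x y + cinner x z"
  by (metis cinner_add_left cinner_commute complex_cnj_add)

lemma cinner_scaleC_right:
  "cinner (x::'h::complex_inner) (c *\<^sub>C y) = cnj c * cinner x y"
  by (metis cinner_scaleC_left cinner_commute complex_cnj_mult)

lemma cinner_zero_left [simp]: "cinner 0 (y::'h::complex_inner) = 0"
  using cinner_add_left[of 0 0 y] by simp

lemma cinner_zero_right [simp]: "cinner (y::'h::complex_inner) 0 = 0"
  using cinner_add_right[of y 0 0] by simp

lemma cinner_minus_left: "cinner (- x) (y::'h::complex_inner) = - cinner x y"
  using cinner_add_left[of "-x" x y] by (simp add: add_eq_0_iff)

lemma cinner_diff_left: "cinner (x - z) (y::'h::complex_inner) = cinner x y - cinner z y"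
  using cinner_add_left[of x "-z" y] by (simp add: cinner_minus_left)

lemma cinner_diff_right: "cinner (y::'h::complex_inner) (x - z) = cinner y x - cinner y z"
  by (metis cinner_diff_left cinner_commute complex_cnj_diff)

lemma cinner_sum_left:
  "cinner (\<Sum>k\<in>F. f k) (y::'h::complex_inner) = (\<Sum>k\<in>F. cinner (f k) y)"
  by (induction F rule: infinite_finite_induct) (simp_all add: cinner_add_left)

lemma cinner_sum_right:
  "cinner (y::'h::complex_inner) (\<Sum>k\<in>F. f k) = (\<Sum>k\<in>F. cinner y (f k))"
  by (induction F rule: infinite_finite_induct) (simp_all add: cinner_add_right)

text \<open>Subtracting from \<open>x\<close> its orthogonal projection \<open>c *\<^sub>C y\<close>
  onto \<open>y\<close> leaves a vector whose squared norm is the defect in the squared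
  Cauchy-Schwarz inequality, divided by \<open>(norm y)\<^sup>2\<close>; it is nonnegative.\<close>

lemma norm_cinner_le: "cmod (cinner x y) \<le> norm x * norm (y::'h::complex_inner)"
proof (cases "y = 0")
  case False
  define c where "c = cinner x y / cinner y y"
  have ny: "cinner y y \<noteq> 0" using False by (simp add: cinner_same)
  have "cinner (x - c *\<^sub>C y) (x - c *\<^sub>C y)
      = cinner x x - cnj c * cinner x y - c * (cinner y x - cnj c * cinner y y)"
    by (simp add: cinner_diff_left cinner_diff_right cinner_scaleC_left
        cinner_scaleC_right algebra_simps)
  also have "cnj c * cinner y y = cinner y x"
    using ny by (simp add: c_def cinner_commute[of x y] cinner_same)
  finally have "cinner (x - c *\<^sub>C y) (x - c *\<^sub>C y) = cinner x x - cnj c * cinner x y" by simp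
  also have "cnj c * cinner x y = complex_of_real ((cmod (cinner x y))\<^sup>2 / (norm y)\<^sup>2)"
    by (simp only: c_def complex_cnj_divide cinner_same complex_cnj_complex_of_real
        of_real_divide complex_norm_square) (simp add: mult.commute)
  finally have "complex_of_real ((norm (x - c *\<^sub>C y))\<^sup>2)
      = complex_of_real ((norm x)\<^sup>2 - (cmod (cinner x y))\<^sup>2 / (norm y)\<^sup>2)"
    by (simp only: cinner_same of_real_diff)
  then have "(norm (x - c *\<^sub>C y))\<^sup>2 = (norm x)\<^sup>2 - (cmod (cinner x y))\<^sup>2 / (norm y)\<^sup>2"
    by (simp only: of_real_eq_iff)
  then have "(cmod (cinner x y))\<^sup>2 / (norm y)\<^sup>2 \<le> (norm x)\<^sup>2"
    by (metis diff_ge_0_iff_ge zero_le_power2)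
  then have "(cmod (cinner x y))\<^sup>2 \<le> (norm x * norm y)\<^sup>2"
    using False by (simp add: field_simps power_mult_distrib)
  then show ?thesis by (rule power2_le_imp_le) simp
qed simp

lemma bounded_linear_cinner_left: "bounded_linear (\<lambda>x. cinner x (y::'h::complex_inner))"
  by (rule bounded_linear_intro[where K = "norm y"])
     (simp_all add: cinner_add_left scaleR_scaleC cinner_scaleC_left norm_cinner_le
       scaleR_conv_of_real)

lemma tendsto_cinner_left:
  "(f \<longlongrightarrow> x) F \<Longrightarrow> ((\<lambda>i. cinner (f i) y) \<longlongrightarrow> cinner x (y::'h::complex_inner)) F"
  by (rule bounded_linear.tendsto[OF bounded_linear_cinner_left])

lemma tendsto_cinner_right:
  assumes "(f \<longlongrightarrow> x) F"
  shows "((\<lambda>i. cinner y (f i)) \<longlongrightarrow> cinner (y::'h::complex_inner) x) F"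
  using tendsto_cnj[OF tendsto_cinner_left[OF assms, of y]] by (simp add: cinner_commute[symmetric])

section \<open>Fourier coefficients: completeness, Riesz-Fischer, Bessel and expansion\<close>

lemma orthonormal_basis_cinner:
  "orthonormal_basis \<psi> \<Longrightarrow> m \<ge> 1 \<Longrightarrow> n \<ge> 1 \<Longrightarrow> cinner (\<psi> m) (\<psi> n) = (if m = n then 1 else 0)"
  by (simp add: orthonormal_basis_def)

text \<open>Such an \<open>x\<close> is orthogonal to the whole span, and by density it is a limit
  of elements of the span; hence it is orthogonal to itself.\<close>

lemma orthonormal_basis_ortho_imp_zero:
  assumes "orthonormal_basis \<psi>" and "\<And>k. k \<ge> 1 \<Longrightarrow> cinner x (\<psi> k) = 0"
  shows "x = 0"
proof -
  have "cinner x y = 0" if "y \<in> complex_vector.span (\<psi> ` {1..})" for y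
    using that
    by (induction rule: complex_vector.span_induct_alt)
       (use assms(2) in \<open>auto simp: cinner_add_right cinner_scaleC_right\<close>)
  moreover have "x \<in> closure (complex_vector.span (\<psi> ` {1..}))"
    using assms(1) by (simp add: orthonormal_basis_def)
  then obtain f where "\<And>i. f i \<in> complex_vector.span (\<psi> ` {1..})" "f \<longlonglongrightarrow> x"
    by (auto simp: closure_sequential)
  ultimately have "(\<lambda>i. 0) \<longlonglongrightarrow> cinner x x"
    using tendsto_cinner_right[of f x sequentially x] by simp
  then have "cinner x x = 0" using LIMSEQ_unique tendsto_const by blast
  then show ?thesis by (simp add: cinner_same)
qed

lemma cinner_basis_sum:
  assumes "orthonormal_basis \<psi>" "finite F" "F \<subseteq> {1..}" "m \<ge> 1"
  shows "cinner (\<Sum>k\<in>F. c k *\<^sub>C \<psi> k) (\<psi> m) = (if m \<in> F then c m else 0)"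
proof -
  have "cinner (\<Sum>k\<in>F. c k *\<^sub>C \<psi> k) (\<psi> m) = (\<Sum>k\<in>F. if k = m then c k else 0)"
    unfolding cinner_sum_left
    by (rule sum.cong)
       (use assms in \<open>auto simp: cinner_scaleC_left orthonormal_basis_cinner subset_iff\<close>)
  then show ?thesis using assms(2) by simp
qed

lemma norm_basis_sum:
  assumes "orthonormal_basis \<psi>" "finite F" "F \<subseteq> {1..}"
  shows "(norm (\<Sum>k\<in>F. c k *\<^sub>C \<psi> k))\<^sup>2 = (\<Sum>k\<in>F. (cmod (c k))\<^sup>2)"
proof -
  have "complex_of_real ((norm (\<Sum>k\<in>F. c k *\<^sub>C \<psi> k))\<^sup>2)
      = (\<Sum>m\<in>F. cnj (c m) * cinner (\<Sum>k\<in>F. c k *\<^sub>C \<psi> k) (\<psi> m))"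
    by (simp only: cinner_same[symmetric] cinner_sum_right cinner_scaleC_right)
  also have "\<dots> = (\<Sum>m\<in>F. complex_of_real ((cmod (c m))\<^sup>2))"
  proof (rule sum.cong)
    fix m assume "m \<in> F"
    then show "cnj (c m) * cinner (\<Sum>k\<in>F. c k *\<^sub>C \<psi> k) (\<psi> m) = complex_of_real ((cmod (c m))\<^sup>2)"
      using cinner_basis_sum[OF assms, of m c] assms(3)
      by (simp add: complex_norm_square mult.commute subset_iff del: of_real_power)
  qed simp
  finally show ?thesis by (simp only: of_real_sum[symmetric] of_real_eq_iff)
qed

text \<open>Riesz-Fischer. By Pythagoras the squared norm of a block of the vector series is the
  same block of the scalar series, so the Cauchy property carries over. Besides Fourier series, this
  produces the image of a vector of \<open>V\<close> under the square root \<open>S\<close>.\<close>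

lemma orthogonal_series_converges:
  assumes "orthonormal_basis \<psi>"
    and bd: "\<And>K. (\<Sum>k\<in>{1..K}. (cmod (c k))\<^sup>2) \<le> B"
  obtains w where "(\<lambda>K. \<Sum>k\<in>{1..K}. c k *\<^sub>C \<psi> k) \<longlonglongrightarrow> w"
    and "\<And>m. m \<ge> 1 \<Longrightarrow> cinner w (\<psi> m) = c m"
proof -
  let ?p = "\<lambda>K. \<Sum>k\<in>{1..K}. c k *\<^sub>C \<psi> k"
  let ?q = "\<lambda>K. \<Sum>k\<in>{1..K}. (cmod (c k))\<^sup>2"
  have "incseq ?q" by (rule incseq_SucI) simp
  then have "Cauchy ?q"
    using bd incseq_convergent[of ?q B] convergent_Cauchy by (metis convergent_def)
  have diff: "(norm (?p K - ?p L))\<^sup>2 = ?q K - ?q L" if "L \<le> K" for K L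
  proof -
    have *: "{1..K} = {1..L} \<union> {Suc L..K}" "{1..L} \<inter> {Suc L..K} = {}" using that by auto
    have "?p K - ?p L = (\<Sum>k\<in>{Suc L..K}. c k *\<^sub>C \<psi> k)"
      by (subst *(1), subst sum.union_disjoint) (use *(2) in auto)
    moreover have "?q K - ?q L = (\<Sum>k\<in>{Suc L..K}. (cmod (c k))\<^sup>2)"
      by (subst *(1), subst sum.union_disjoint) (use *(2) in auto)
    ultimately show ?thesis
      using norm_basis_sum[OF assms(1), of "{Suc L..K}" c] by auto
  qed
  have "Cauchy ?p"
  proof (rule CauchyI)
    fix e :: real assume "e > 0"
    then obtain M where M: "\<And>m n. m \<ge> M \<Longrightarrow> n \<ge> M \<Longrightarrow> norm (?q m - ?q n) < e\<^sup>2"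
      using CauchyD[OF \<open>Cauchy ?q\<close>, of "e\<^sup>2"] by auto
    have le: "norm (?p m - ?p n) < e" if "m \<ge> M" "n \<ge> M" "n \<le> m" for m n
    proof (rule power_less_imp_less_base)
      show "(norm (?p m - ?p n))\<^sup>2 < e\<^sup>2"
        using M[OF that(1,2)] diff[OF that(3)] by simp
    qed (use \<open>e > 0\<close> in simp)
    show "\<exists>M. \<forall>m\<ge>M. \<forall>n\<ge>M. norm (?p m - ?p n) < e"
      by (rule exI[of _ M]) (metis le linear norm_minus_commute)
  qed
  then obtain w where w: "?p \<longlonglongrightarrow> w"
    using Cauchy_convergent convergent_def by blast
  moreover have "cinner w (\<psi> m) = c m" if "m \<ge> 1" for m
  proof -
    have "(\<lambda>K. cinner (?p K) (\<psi> m)) \<longlonglongrightarrow> cinner w (\<psi> m)"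
      by (rule tendsto_cinner_left[OF w])
    moreover have "\<forall>\<^sub>F K in sequentially. cinner (?p K) (\<psi> m) = c m"
      using eventually_ge_at_top[of m]
    proof eventually_elim
      case (elim K)
      then show ?case using cinner_basis_sum[OF assms(1), of "{1..K}" m c] that by auto
    qed
    then have "(\<lambda>K. cinner (?p K) (\<psi> m)) \<longlonglongrightarrow> c m"
      by (rule tendsto_eventually)
    ultimately show ?thesis using LIMSEQ_unique by blast
  qed
  ultimately show ?thesis using that by blast
qed

lemma bessel_inequality:
  assumes "orthonormal_basis \<psi>"
  shows "(\<Sum>k\<in>{1..K}. (cmod (cinner u (\<psi> k)))\<^sup>2) \<le> (norm u)\<^sup>2"
proof -
  let ?p = "\<Sum>k\<in>{1..K}. cinner u (\<psi> k) *\<^sub>C \<psi> k"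
  let ?q = "\<Sum>k\<in>{1..K}. (cmod (cinner u (\<psi> k)))\<^sup>2"
  have pp: "cinner ?p ?p = complex_of_real ?q"
    using norm_basis_sum[OF assms, of "{1..K}" "\<lambda>k. cinner u (\<psi> k)"] unfolding cinner_same
    by (simp only: of_real_eq_iff) auto
  have up: "cinner u ?p = complex_of_real ?q"
    by (simp add: cinner_sum_right cinner_scaleC_right complex_norm_square mult.commute
        del: of_real_power)
  then have pu: "cinner ?p u = complex_of_real ?q"
    by (metis cinner_commute complex_cnj_complex_of_real)
  have "complex_of_real ((norm (u - ?p))\<^sup>2) = complex_of_real ((norm u)\<^sup>2 - ?q)"
    unfolding cinner_same[symmetric] cinner_diff_left cinner_diff_right pp up pu of_real_diff
    by simp
  then have "(norm (u - ?p))\<^sup>2 = (norm u)\<^sup>2 - ?q" by (simp only: of_real_eq_iff)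
  then show ?thesis by (metis diff_ge_0_iff_ge zero_le_power2)
qed

text \<open>Bessel and Riesz-Fischer give some limit \<open>w\<close>; it has the same coefficients
  as \<open>u\<close>, so \<open>w - u\<close> is orthogonal to the basis and vanishes.\<close>

lemma basis_expansion:
  assumes "orthonormal_basis \<psi>"
  shows "(\<lambda>K. \<Sum>k\<in>{1..K}. cinner u (\<psi> k) *\<^sub>C \<psi> k) \<longlonglongrightarrow> u"
proof -
  obtain w where w: "(\<lambda>K. \<Sum>k\<in>{1..K}. cinner u (\<psi> k) *\<^sub>C \<psi> k) \<longlonglongrightarrow> w"
      "\<And>m. m \<ge> 1 \<Longrightarrow> cinner w (\<psi> m) = cinner u (\<psi> m)"
    using orthogonal_series_converges[OF assms bessel_inequality[OF assms]] by blast
  then have "w - u = 0"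
    by (intro orthonormal_basis_ortho_imp_zero[OF assms]) (simp add: cinner_diff_left)
  with w(1) show ?thesis by simp
qed

text \<open>The part of Parseval's identity that turns coefficient bounds on \<open>\<phi> n\<close>
  into norm bounds at the end.\<close>

lemma norm_le_of_coefficients:
  assumes "orthonormal_basis \<psi>"
    and "\<And>K. (\<Sum>k\<in>{1..K}. (cmod (cinner w (\<psi> k)))\<^sup>2) \<le> B"
  shows "(norm w)\<^sup>2 \<le> B"
proof -
  have "(\<lambda>K. (norm (\<Sum>k\<in>{1..K}. cinner w (\<psi> k) *\<^sub>C \<psi> k))\<^sup>2) \<longlonglongrightarrow> (norm w)\<^sup>2"
    by (intro tendsto_intros basis_expansion assms)
  then show ?thesis
    by (rule LIMSEQ_le_const2)
       (use norm_basis_sum[OF assms(1), of "{1.._}" "\<lambda>k. cinner w (\<psi> k)"] assms(2) in auto)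
qed

section \<open>The square root of the operator\<close>

text \<open>The defining identities of an adjoint survive limits. Since \<open>S\<close> equals its
  adjoint, this makes \<open>S\<close> a closed operator.\<close>

lemma adjoint_op_closed:
  assumes "\<And>i::nat. (f i, g i) \<in> adjoint_op S" "f \<longlonglongrightarrow> x" "g \<longlonglongrightarrow> y"
  shows "(x, y) \<in> adjoint_op S"
proof -
  have "cinner w x = cinner u y" if "(u, w) \<in> S" for u w
  proof -
    have "(\<lambda>i. cinner w (f i)) \<longlonglongrightarrow> cinner w x" "(\<lambda>i. cinner u (g i)) \<longlonglongrightarrow> cinner u y"
      by (intro tendsto_cinner_right assms)+
    moreover have "(\<lambda>i. cinner w (f i)) = (\<lambda>i. cinner u (g i))"
      using assms(1) that by (force simp: adjoint_op_def)
    ultimately show ?thesis using LIMSEQ_unique by auto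
  qed
  then show ?thesis by (auto simp: adjoint_op_def)
qed

text \<open>The definition of \<open>self_adjoint\<close> does not mention linearity. An adjoint
  graph is linear whatever the original relation is, and a self-adjoint \<open>S\<close> inherits
  this.\<close>

lemma adjoint_op_add:
  "(u, w) \<in> adjoint_op S \<Longrightarrow> (u', w') \<in> adjoint_op S \<Longrightarrow> (u + u', w + w') \<in> adjoint_op S"
  by (fastforce simp: adjoint_op_def cinner_add_right)

lemma adjoint_op_scaleC: "(u, w) \<in> adjoint_op S \<Longrightarrow> (c *\<^sub>C u, c *\<^sub>C w) \<in> adjoint_op S"
  by (fastforce simp: adjoint_op_def cinner_scaleC_right)

lemma adjoint_op_diff:
  "(u, w) \<in> adjoint_op S \<Longrightarrow> (u', w') \<in> adjoint_op S \<Longrightarrow> (u - u', w - w') \<in> adjoint_op S"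
  by (fastforce simp: adjoint_op_def cinner_diff_right)

lemma adjoint_op_sum:
  "(\<And>k. k \<in> F \<Longrightarrow> (f k, g k) \<in> adjoint_op S) \<Longrightarrow> (sum f F, sum g F) \<in> adjoint_op S"
proof (induction F rule: infinite_finite_induct)
  case (insert x F)
  then show ?case by (simp add: adjoint_op_add)
qed (auto simp: adjoint_op_def)

text \<open>The difference of two images is orthogonal to the dense domain. This makes the definite
  description in \<open>op_app\<close> meaningful.\<close>

lemma self_adjoint_single_valued:
  assumes "self_adjoint S" "(u, w) \<in> S" "(u, w') \<in> S"
  shows "w = w'"
proof -
  have "w - w' \<in> closure (Domain S)" using assms by (simp add: self_adjoint_def)
  then obtain f where f: "\<And>i. f i \<in> Domain S" "f \<longlonglongrightarrow> w - w'"
    by (auto simp: closure_sequential)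
  have "cinner v (w - w') = 0" if "v \<in> Domain S" for v
  proof -
    obtain y where "(v, y) \<in> S" using \<open>v \<in> Domain S\<close> by auto
    moreover have "(u, w) \<in> adjoint_op S" "(u, w') \<in> adjoint_op S"
      using assms by (simp_all add: self_adjoint_def)
    ultimately show ?thesis by (force simp: adjoint_op_def cinner_diff_right)
  qed
  then have "(\<lambda>i. 0) \<longlonglongrightarrow> cinner (w - w') (w - w')"
    using tendsto_cinner_left[OF f(2), of "w - w'"] f(1) by simp
  then have "cinner (w - w') (w - w') = 0" using LIMSEQ_unique tendsto_const by blast
  then show ?thesis by (simp add: cinner_same)
qed

lemma op_app_eq: "self_adjoint S \<Longrightarrow> (u, w) \<in> S \<Longrightarrow> op_app S u = w"
  unfolding op_app_def by (rule the_equality) (auto intro: self_adjoint_single_valued)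

text \<open>\<open>(S + \<surd>\<mu>)(S - \<surd>\<mu>)\<psi> = 0\<close> and \<open>S + \<surd>\<mu>\<close> is injective because \<open>S \<ge> 0\<close>.\<close>

lemma sqrt_op_eigenvector:
  assumes "is_sqrt_op S A" "(\<psi>, complex_of_real \<mu> *\<^sub>C \<psi>) \<in> A" "\<mu> > 0"
  shows "(\<psi>, complex_of_real (sqrt \<mu>) *\<^sub>C \<psi>) \<in> S"
proof -
  let ?\<nu> = "complex_of_real (sqrt \<mu>)"
  have S: "adjoint_op S = S" using assms(1) by (simp add: is_sqrt_op_def self_adjoint_def)
  have "(\<psi>, complex_of_real \<mu> *\<^sub>C \<psi>) \<in> S O S" using assms(1,2) by (simp add: is_sqrt_op_def)
  then obtain w where w: "(\<psi>, w) \<in> S" "(w, complex_of_real \<mu> *\<^sub>C \<psi>) \<in> S" by auto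
  define y where "y = w - ?\<nu> *\<^sub>C \<psi>"
  have "(y, complex_of_real \<mu> *\<^sub>C \<psi> - ?\<nu> *\<^sub>C w) \<in> S"
    unfolding y_def using adjoint_op_diff[of _ _ S] adjoint_op_scaleC[of _ _ S] w unfolding S by blast
  moreover have "complex_of_real \<mu> *\<^sub>C \<psi> = ?\<nu> *\<^sub>C ?\<nu> *\<^sub>C \<psi>"
    using assms(3) by (simp add: scaleC_scaleC flip: of_real_mult)
  ultimately have "(y, (- ?\<nu>) *\<^sub>C y) \<in> S"
    by (simp add: y_def complex_vector.scale_right_diff_distrib)
  then have "0 \<le> Re (cinner ((- ?\<nu>) *\<^sub>C y) y)"
    using assms(1) by (fastforce simp: is_sqrt_op_def)
  then have "0 \<le> - (sqrt \<mu> * (norm y)\<^sup>2)"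
    by (simp add: cinner_scaleC_left cinner_same cinner_minus_left flip: of_real_mult of_real_power)
  then have "y = 0"
    using assms(3) by (simp add: mult_le_0_iff)
  then show ?thesis using w(1) by (simp add: y_def)
qed

section \<open>Bessel's inequality for the form \<open>a\<close>\<close>

text \<open>The eigenvectors are also orthogonal for \<open>a\<close>, with
  \<open>a (\<psi> k) (\<psi> k) = \<mu> k\<close>. Removing the components of \<open>u\<close> one
  by one lowers the value of \<open>a\<close> by \<open>\<mu> k\<close> times the squared modulus of
  the coefficient, and positivity keeps the remainder nonnegative.\<close>

lemma form_bessel_inequality:
  assumes "orthonormal_basis \<psi>"
    and sesq: "sesquilinear_on V a" and herm: "hermitian_on V a"
    and pd: "positive_definite_on V a"
    and eig: "\<And>k. k \<ge> 1 \<Longrightarrow> (\<psi> k, complex_of_real (\<mu> k) *\<^sub>C \<psi> k) \<in> form_op V a"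
    and u: "u \<in> V"
  shows "(\<Sum>k\<in>{1..K}. \<mu> k * (cmod (cinner u (\<psi> k)))\<^sup>2) \<le> Re (a u u)"
proof -
  let ?p = "\<lambda>K. \<Sum>k\<in>{1..K}. cinner u (\<psi> k) *\<^sub>C \<psi> k"
  have sub: "complex_vector.subspace V" using sesq by (simp add: sesquilinear_on_def)
  have psi: "\<psi> k \<in> V" if "k \<ge> 1" for k using eig[OF that] by (simp add: form_op_def)
  have apsi: "a (\<psi> k) v = of_real (\<mu> k) * cinner (\<psi> k) v" if "k \<ge> 1" "v \<in> V" for k v
    using eig[OF that(1)] that(2) by (simp add: form_op_def cinner_scaleC_left)
  have a_psi: "a v (\<psi> k) = of_real (\<mu> k) * cinner v (\<psi> k)" if "k \<ge> 1" "v \<in> V" for k v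
  proof -
    have "a v (\<psi> k) = cnj (a (\<psi> k) v)"
      using herm psi[OF that(1)] that(2) unfolding hermitian_on_def by blast
    then show ?thesis by (simp add: apsi[OF that] cinner_commute[of v "\<psi> k"])
  qed
  have main: "?p K \<in> V \<and> a (u - ?p K) (u - ?p K)
      = a u u - complex_of_real (\<Sum>k\<in>{1..K}. \<mu> k * (cmod (cinner u (\<psi> k)))\<^sup>2)"
  proof (induction K)
    case 0
    then show ?case using complex_vector.subspace_0[OF sub] by simp
  next
    case (Suc K)
    let ?c = "cinner u (\<psi> (Suc K))"
    let ?r = "u - ?p K"
    have r: "?r \<in> V" using Suc u sub complex_vector.subspace_diff by blast
    have cp: "- ?c *\<^sub>C \<psi> (Suc K) \<in> V"
      using sub psi complex_vector.subspace_scale by (metis le_add1 plus_1_eq_Suc)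
    have p: "u - ?p (Suc K) = ?r + (- ?c) *\<^sub>C \<psi> (Suc K)"
      by simp
    have inV: "?p (Suc K) \<in> V"
    proof -
      have "u - (u - ?p (Suc K)) \<in> V"
        unfolding p using sub u r cp complex_vector.subspace_diff complex_vector.subspace_add by metis
      then show ?thesis by (simp add: add.commute)
    qed
    have rc: "cinner ?r (\<psi> (Suc K)) = ?c"
      using cinner_basis_sum[OF assms(1), of "{1..K}" "Suc K"] by (auto simp: cinner_diff_left)
    have "a (u - ?p (Suc K)) (u - ?p (Suc K))
       = a ?r ?r + cnj (- ?c) * a ?r (\<psi> (Suc K)) + (- ?c) * a (\<psi> (Suc K)) ?r
          + (- ?c) * cnj (- ?c) * a (\<psi> (Suc K)) (\<psi> (Suc K))"
    proof -
      have add: "\<And>x y w. x \<in> V \<Longrightarrow> y \<in> V \<Longrightarrow> w \<in> V \<Longrightarrow> a (x + y) w = a x w + a y w"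
          "\<And>x y w. x \<in> V \<Longrightarrow> y \<in> V \<Longrightarrow> w \<in> V \<Longrightarrow> a w (x + y) = a w x + a w y"
          "\<And>c x y. x \<in> V \<Longrightarrow> y \<in> V \<Longrightarrow> a (c *\<^sub>C x) y = c * a x y"
          "\<And>c x y. x \<in> V \<Longrightarrow> y \<in> V \<Longrightarrow> a x (c *\<^sub>C y) = cnj c * a x y"
        using sesq by (simp_all add: sesquilinear_on_def)
      have s: "?r + (- ?c) *\<^sub>C \<psi> (Suc K) \<in> V"
        using sub r cp complex_vector.subspace_add by blast
      have ps: "\<psi> (Suc K) \<in> V" by (simp add: psi)
      show ?thesis
        unfolding p add(1)[OF r cp s] add(2)[OF r cp r] add(2)[OF r cp cp]
          add(3)[OF ps r] add(4)[OF r ps] add(3)[OF ps cp] add(4)[OF ps ps]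
        by (simp only: mult.assoc add.assoc)
    qed
    \<comment> \<open>The remainder \<open>?r\<close> still has the coefficient \<open>?c\<close>
      along the next eigenvector. So each of the two mixed terms contributes
      \<open>- \<mu> (Suc K)\<close> times the squared modulus of \<open>?c\<close>, and the
      diagonal term gives one of them back.\<close>
    also have "\<dots> = a ?r ?r - of_real (\<mu> (Suc K)) * (?c * cnj ?c)"
    proof -
      have 1: "a (\<psi> (Suc K)) ?r = of_real (\<mu> (Suc K)) * cnj ?c"
        using rc apsi[OF _ r, of "Suc K"] cinner_commute[of "\<psi> (Suc K)" ?r] by simp
      have 2: "a ?r (\<psi> (Suc K)) = of_real (\<mu> (Suc K)) * ?c"
        using rc a_psi[OF _ r, of "Suc K"] by simp
      have 3: "a (\<psi> (Suc K)) (\<psi> (Suc K)) = of_real (\<mu> (Suc K))"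
        using orthonormal_basis_cinner[OF assms(1), of "Suc K" "Suc K"]
          apsi[OF _ psi, of "Suc K" "Suc K"] by simp
      show ?thesis unfolding 1 2 3 by (simp add: algebra_simps)
    qed
    also have "\<dots> = a u u - complex_of_real (\<Sum>k\<in>{1..Suc K}. \<mu> k * (cmod (cinner u (\<psi> k)))\<^sup>2)"
      by (simp only: conjunct2[OF Suc] complex_norm_square[symmetric] sum.atLeast_Suc_atMost_Suc_shift)
         (simp add: complex_norm_square[symmetric])
    finally show ?case using inV by blast
  qed
  \<comment> \<open>\<open>positive_definite_on\<close> speaks of nonzero vectors only; at
    \<open>0\<close> the form vanishes by homogeneity.\<close>
  have nonneg: "0 \<le> Re (a v v)" if "v \<in> V" for v
  proof (cases "v = 0")
    case True
    have "a (0 *\<^sub>C u) u = 0 * a u u"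
      using sesq u unfolding sesquilinear_on_def by blast
    moreover have "a 0 0 = a (0 *\<^sub>C u) (0 *\<^sub>C u)" by simp
    ultimately have "a 0 0 = 0"
      using sesq u unfolding sesquilinear_on_def
      by (metis complex_vector.scale_zero_left complex_vector.subspace_0 mult_zero_left)
    then show ?thesis using True by simp
  next
    case False
    then show ?thesis using pd that by (simp add: positive_definite_on_def less_imp_le)
  qed
  have "u - ?p K \<in> V" using complex_vector.subspace_diff[OF sub u] main by blast
  from nonneg[OF this] show ?thesis by (simp only: conjunct2[OF main]) simp
qed

section \<open>Estimates for power kernels\<close>

text \<open>The absolute value in the constant covers both signs of the exponent:
  \<open>powr\<close> is increasing in its base for \<open>r \<ge> 0\<close> and decreasing for
  \<open>r < 0\<close>.\<close>

lemma powr_comparable: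
  fixes x y r :: real
  assumes "0 < x" "x \<le> 2 * y" "y \<le> 2 * x"
  shows "x powr r \<le> 2 powr \<bar>r\<bar> * y powr r"
proof (cases "r \<ge> 0")
  case True
  have "x powr r \<le> (2 * y) powr r" using assms True by (intro powr_mono2) auto
  then show ?thesis using True assms by (simp add: powr_mult)
next
  case False
  have "x powr r \<le> (y / 2) powr r" using assms False by (intro powr_mono2') auto
  also have "\<dots> = 2 powr (- r) * y powr r"
    using assms by (simp add: powr_divide powr_minus_divide)
  finally show ?thesis using False by simp
qed

text \<open>Away from the diagonal \<open>\<bar>x - y\<bar>\<close> is comparable to the maximum; near it \<open>x\<close> and \<open>y\<close> are comparable
  and at least \<open>\<bar>x - y\<bar>\<close>.\<close>

lemma first_kernel_bound:
  fixes x y \<alpha> \<gamma> \<epsilon> p :: real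
  assumes x: "1 \<le> x" and y: "1 \<le> y" and d: "1 \<le> \<bar>x - y\<bar>"
    and e: "0 < \<epsilon>" "\<epsilon> \<le> \<gamma>" and p: "1 \<le> p" "p \<le> 2 * \<alpha> + \<gamma> - \<epsilon>"
  shows "x powr (- (2 * \<alpha>)) * max x y powr (1 - \<gamma>) / \<bar>x - y\<bar>
    \<le> (2 + 2 powr \<bar>1 - \<gamma>\<bar> * 2 powr \<epsilon>) * y powr (- \<epsilon>) * (x powr (- p) + \<bar>x - y\<bar> powr (- p))"
    (is "?L \<le> ?C * _ * _")
proof (cases "max x y \<le> 2 * \<bar>x - y\<bar>")
  case True
  let ?M = "max x y" let ?d = "\<bar>x - y\<bar>"
  have M: "?M > 0" using x by auto
  have "?M powr (1 - \<gamma>) = ?M * ?M powr (- \<gamma>)"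
    using M powr_add[of ?M 1 "-\<gamma>"] by simp
  also have "\<dots> \<le> (2 * ?d) * ?M powr (- \<gamma>)" using True by (intro mult_right_mono) auto
  finally have "?M powr (1 - \<gamma>) / ?d \<le> 2 * ?M powr (- \<gamma>)"
    using d by (simp add: divide_simps mult_ac)
  \<comment> \<open>The decay in the maximum is shared out: the exponent \<open>\<epsilon>\<close>
    goes to \<open>y\<close>, and the rest joins \<open>2 * \<alpha>\<close> on \<open>x\<close>,
    where it makes up at least \<open>p\<close>.\<close>
  also have "?M powr (- \<gamma>) = ?M powr (- (\<gamma> - \<epsilon>)) * ?M powr (- \<epsilon>)"
    by (simp add: powr_add[symmetric])
  also have "\<dots> \<le> x powr (- (\<gamma> - \<epsilon>)) * y powr (- \<epsilon>)"
    using x y e by (intro mult_mono powr_mono2') auto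
  finally have 1: "?M powr (1 - \<gamma>) / ?d \<le> 2 * (x powr (- (\<gamma> - \<epsilon>)) * y powr (- \<epsilon>))" by simp
  have "?L = x powr (- (2 * \<alpha>)) * (?M powr (1 - \<gamma>) / ?d)" by simp
  also have "\<dots> \<le> x powr (- (2 * \<alpha>)) * (2 * (x powr (- (\<gamma> - \<epsilon>)) * y powr (- \<epsilon>)))"
    using 1 by (intro mult_left_mono) auto
  also have "\<dots> = 2 * y powr (- \<epsilon>) * x powr (- (2 * \<alpha> + \<gamma> - \<epsilon>))"
    by (simp add: powr_add[symmetric] algebra_simps)
  also have "\<dots> \<le> ?C * y powr (- \<epsilon>) * (x powr (- p) + ?d powr (- p))"
    using x y p by (intro mult_mono add_increasing2 powr_mono) auto
  finally show ?thesis .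
next
  case False
  let ?M = "max x y" let ?d = "\<bar>x - y\<bar>"
  have c: "x \<le> 2 * y" "y \<le> 2 * x" "?M \<le> 2 * x" "x \<le> 2 * ?M" "?d \<le> x"
    using False x y by (auto simp: max_def abs_if split: if_splits)
  have "?L \<le> x powr (- (2 * \<alpha>)) * (2 powr \<bar>1 - \<gamma>\<bar> * x powr (1 - \<gamma>)) / ?d"
    using x c by (intro divide_right_mono mult_left_mono powr_comparable) auto
  \<comment> \<open>All powers are now powers of \<open>x\<close>. The part with exponent
    \<open>\<epsilon>\<close> is moved to \<open>y\<close> by comparability; the other part is moved
    to the distance, which is at most \<open>x\<close>, and combines with the reciprocal of the
    distance to the exponent \<open>p\<close>.\<close>
  also have "\<dots> = 2 powr \<bar>1 - \<gamma>\<bar> * (x powr (- \<epsilon>) * x powr (- (2 * \<alpha> + \<gamma> - \<epsilon> - 1))) * ?d powr (- 1)"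
  proof -
    have "x powr (- (2 * \<alpha>)) * x powr (1 - \<gamma>) = x powr (- \<epsilon>) * x powr (- (2 * \<alpha> + \<gamma> - \<epsilon> - 1))"
      by (simp only: powr_add[symmetric], rule arg_cong[where f = "(powr) x"]) (simp add: algebra_simps)
    then show ?thesis using d by (simp add: powr_minus_divide mult.left_commute)
  qed
  also have "\<dots> \<le> 2 powr \<bar>1 - \<gamma>\<bar> * ((2 powr \<bar>- \<epsilon>\<bar> * y powr (- \<epsilon>)) * ?d powr (- (p - 1))) * ?d powr (- 1)"
  proof -
    have "x powr (- (2 * \<alpha> + \<gamma> - \<epsilon> - 1)) \<le> x powr (- (p - 1))"
      using x p by (intro powr_mono) auto
    also have "\<dots> \<le> ?d powr (- (p - 1))"
      using c d p by (intro powr_mono2') auto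
    finally show ?thesis
      using x c by (intro mult_right_mono mult_left_mono mult_mono powr_comparable) auto
  qed
  also have "\<dots> = (2 powr \<bar>1 - \<gamma>\<bar> * 2 powr \<epsilon>) * y powr (- \<epsilon>) * ?d powr (- p)"
  proof -
    have "?d powr (- p) = ?d powr (- (p - 1)) * ?d powr (- 1)"
      by (simp only: powr_add[symmetric]) simp
    then show ?thesis using e by (simp add: mult_ac)
  qed
  also have "\<dots> \<le> ?C * y powr (- \<epsilon>) * (x powr (- p) + ?d powr (- p))"
    by (intro mult_mono) auto
  finally show ?thesis .
qed

text \<open>The same case split as in \<open>first_kernel_bound\<close>. Away from the diagonal the
  factor \<open>max x y powr (- (2 * \<gamma>))\<close> absorbs
  \<open>(x * y) powr (p - 2 * \<alpha>)\<close>, by \<open>p \<le> 2 * \<alpha> + \<gamma>\<close>.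
  Near it the kernel behaves like \<open>y powr (- (2 * (2 * \<alpha> + \<gamma> - 1)))\<close> over
  the squared distance, and the two other upper bounds on \<open>p\<close> enter.\<close>

lemma second_kernel_bound:
  fixes x y \<alpha> \<gamma> p :: real
  assumes x: "1 \<le> x" and y: "1 \<le> y" and d: "1 \<le> \<bar>x - y\<bar>"
    and g: "\<gamma> > 0" and p: "1 \<le> p" "p \<le> 2" "p \<le> 2 * \<alpha> + \<gamma>" "p \<le> 2 * (2 * \<alpha> + \<gamma> - 1)"
  shows "y powr (- (2 * \<alpha>)) * x powr (- (2 * \<alpha>)) * max x y powr (2 - 2 * \<gamma>) / \<bar>x - y\<bar>\<^sup>2
    \<le> (4 + 2 powr \<bar>2 * \<alpha>\<bar> * 2 powr \<bar>2 - 2 * \<gamma>\<bar>) * y powr (- p) * (x powr (- p) + \<bar>x - y\<bar> powr (- p))"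
    (is "?L \<le> ?C * _ * _")
proof (cases "max x y \<le> 2 * \<bar>x - y\<bar>")
  case True
  let ?M = "max x y" let ?d = "\<bar>x - y\<bar>"
  have M: "?M \<ge> 1" using x by auto
  have "?M powr (2 - 2 * \<gamma>) = ?M\<^sup>2 * ?M powr (- (2 * \<gamma>))"
    using M powr_add[of ?M 2 "-(2*\<gamma>)"] by simp
  also have "\<dots> \<le> (2 * ?d)\<^sup>2 * ?M powr (- (2 * \<gamma>))"
    using True M by (intro mult_right_mono power_mono) auto
  finally have 1: "?M powr (2 - 2 * \<gamma>) / ?d\<^sup>2 \<le> 4 * ?M powr (- (2 * \<gamma>))"
    using d by (simp add: divide_simps mult_ac power_mult_distrib)
  \<comment> \<open>If the exponent is nonpositive, the left side is at most \<open>1\<close> and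
    the right side at least \<open>1\<close>; otherwise both \<open>x\<close> and \<open>y\<close>
    are replaced by the maximum.\<close>
  have "(x * y) powr (p - 2 * \<alpha>) \<le> ?M powr (2 * \<gamma>)"
  proof (cases "p - 2 * \<alpha> \<le> 0")
    case True
    have "1 \<le> x * y" using x y by (metis mult_mono mult_1 zero_le_one order_trans)
    then have "(x * y) powr (p - 2 * \<alpha>) \<le> (x * y) powr 0" using True by (intro powr_mono)
    also have "\<dots> \<le> ?M powr 0" using M x y by auto
    also have "\<dots> \<le> ?M powr (2 * \<gamma>)" using g M by (intro powr_mono) auto
    finally show ?thesis .
  next
    case False
    have "(x * y) powr (p - 2 * \<alpha>) \<le> (?M * ?M) powr (p - 2 * \<alpha>)"
      using False x y by (intro powr_mono2 mult_mono) auto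
    also have "\<dots> = ?M powr (2 * (p - 2 * \<alpha>))"
      using M by (simp add: powr_mult powr_add[symmetric])
    also have "\<dots> \<le> ?M powr (2 * \<gamma>)"
      using M p by (intro powr_mono) auto
    finally show ?thesis .
  qed
  then have "(x * y) powr (- p) * ((x * y) powr (p - 2 * \<alpha>) * ?M powr (- (2 * \<gamma>)))
      \<le> (x * y) powr (- p) * (?M powr (2 * \<gamma>) * ?M powr (- (2 * \<gamma>)))"
    by (intro mult_left_mono mult_right_mono) auto
  also have "?M powr (2 * \<gamma>) * ?M powr (- (2 * \<gamma>)) = 1"
    using M by (simp add: powr_add[symmetric])
  also have "(x * y) powr (- p) * ((x * y) powr (p - 2 * \<alpha>) * ?M powr (- (2 * \<gamma>)))
     = y powr (- (2 * \<alpha>)) * x powr (- (2 * \<alpha>)) * ?M powr (- (2 * \<gamma>))"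
  proof -
    have "(x * y) powr (- p) * (x * y) powr (p - 2 * \<alpha>) = (x * y) powr (- (2 * \<alpha>))"
      by (simp only: powr_add[symmetric]) simp
    then show ?thesis using x y by (simp add: mult.assoc[symmetric] powr_mult[of x y "- (2 * \<alpha>)"])
  qed
  finally have 2: "y powr (- (2 * \<alpha>)) * x powr (- (2 * \<alpha>)) * ?M powr (- (2 * \<gamma>)) \<le> x powr (- p) * y powr (- p)"
    using x y by (simp add: powr_mult)
  have "?L = y powr (- (2 * \<alpha>)) * x powr (- (2 * \<alpha>)) * (?M powr (2 - 2 * \<gamma>) / ?d\<^sup>2)" by simp
  also have "\<dots> \<le> y powr (- (2 * \<alpha>)) * x powr (- (2 * \<alpha>)) * (4 * ?M powr (- (2 * \<gamma>)))"
    using 1 by (intro mult_left_mono) auto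
  also have "\<dots> \<le> 4 * y powr (- p) * x powr (- p)" using 2 by (simp add: mult_ac)
  also have "\<dots> \<le> ?C * y powr (- p) * (x powr (- p) + ?d powr (- p))"
    by (intro mult_mono) auto
  finally show ?thesis .
next
  case False
  let ?M = "max x y" let ?d = "\<bar>x - y\<bar>"
  have c: "x \<le> 2 * y" "y \<le> 2 * x" "?M \<le> 2 * y" "y \<le> 2 * ?M"
    using False x y by (auto simp: max_def abs_if split: if_splits)
  have "?L \<le> y powr (- (2 * \<alpha>)) * (2 powr \<bar>- (2 * \<alpha>)\<bar> * y powr (- (2 * \<alpha>)))
      * (2 powr \<bar>2 - 2 * \<gamma>\<bar> * y powr (2 - 2 * \<gamma>)) / ?d\<^sup>2"
    using x y c by (intro divide_right_mono mult_mono powr_comparable mult_nonneg_nonneg) auto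
  also have "\<dots> = (2 powr \<bar>2 * \<alpha>\<bar> * 2 powr \<bar>2 - 2 * \<gamma>\<bar>) * y powr (- (2 * (2 * \<alpha> + \<gamma> - 1))) * ?d powr (- 2)"
  proof -
    have "y powr (- (2 * (2 * \<alpha> + \<gamma> - 1))) = y powr (- (2 * \<alpha>)) * y powr (- (2 * \<alpha>)) * y powr (2 - 2 * \<gamma>)"
      by (simp only: powr_add[symmetric], rule arg_cong[where f = "(powr) y"]) (simp add: algebra_simps)
    moreover have "?d powr (- 2) = 1 / ?d\<^sup>2"
      using d by (simp add: powr_minus_divide)
    ultimately show ?thesis by simp
  qed
  also have "\<dots> \<le> ?C * y powr (- p) * (x powr (- p) + ?d powr (- p))"
    using d y p by (intro mult_mono add_increasing powr_mono) auto
  finally show ?thesis .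
qed

section \<open>Uniform summation and lower bounds for eigenvalue differences\<close>

text \<open>Uniformity in \<open>n\<close>: the indices to the left and to the right of
  \<open>n\<close> each map injectively to their distance from \<open>n\<close>. With the
  untranslated terms this makes three partial sums of one convergent series.\<close>

lemma sum_powr_translate_bound:
  fixes p :: real
  assumes "p > 1"
  obtains Z where "Z > 0"
    and "\<And>(n::nat) F. finite F \<Longrightarrow> F \<subseteq> {1..} - {n} \<Longrightarrow>
      (\<Sum>m\<in>F. real m powr (- p) + \<bar>real m - real n\<bar> powr (- p)) \<le> Z"
proof -
  \<comment> \<open>Since \<open>0 powr (- p)\<close> is \<open>0\<close>, the series may start at
    index \<open>0\<close>, and a term with \<open>m = n\<close> in a translated sum is
    harmless.\<close>
  let ?z = "\<Sum>k. real k powr (- p)"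
  have sm: "summable (\<lambda>k. real k powr (- p))"
    using assms by (simp add: summable_real_powr_iff)
  have le: "(\<Sum>m\<in>F. real m powr (- p)) \<le> ?z" if "finite F" for F
    using that by (intro sum_le_suminf sm) auto
  have z: "0 \<le> ?z" by (intro suminf_nonneg sm) auto
  have tr: "(\<Sum>m\<in>F. \<bar>real m - real n\<bar> powr (- p)) \<le> 2 * ?z" if F: "finite F" for n F
  proof -
    have sp: "F = {m\<in>F. m < n} \<union> {m\<in>F. n \<le> m}" "{m\<in>F. m < n} \<inter> {m\<in>F. n \<le> m} = {}" by auto
    have "(\<Sum>m\<in>{m\<in>F. m < n}. \<bar>real m - real n\<bar> powr (- p))
        = (\<Sum>j\<in>(\<lambda>m. n - m) ` {m\<in>F. m < n}. real j powr (- p))"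
      by (subst sum.reindex) (auto simp: inj_on_def of_nat_diff abs_minus_commute intro!: sum.cong)
    moreover have "(\<Sum>m\<in>{m\<in>F. n \<le> m}. \<bar>real m - real n\<bar> powr (- p))
        = (\<Sum>j\<in>(\<lambda>m. m - n) ` {m\<in>F. n \<le> m}. real j powr (- p))"
      by (subst sum.reindex) (auto simp: inj_on_def of_nat_diff intro!: sum.cong)
    moreover have "\<dots> \<le> ?z" "(\<Sum>j\<in>(\<lambda>m. n - m) ` {m\<in>F. m < n}. real j powr (- p)) \<le> ?z"
      using F by (auto intro!: le)
    ultimately show ?thesis
      by (subst sp(1), subst sum.union_disjoint) (use sp(2) F in auto)
  qed
  show ?thesis
  proof (rule that[of "3 * ?z + 1"])
    fix n :: nat and F assume "finite F" "F \<subseteq> {1..} - {n}"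
    then show "(\<Sum>m\<in>F. real m powr (- p) + \<bar>real m - real n\<bar> powr (- p)) \<le> 3 * ?z + 1"
      using le[of F] tr[of F n] by (simp add: sum.distrib)
  qed (use z in simp)
qed

text \<open>The gap condition is telescoped over the upper half of the range from \<open>m\<close>
  to \<open>n\<close> only. There every index is comparable with \<open>n\<close>, so its power is
  comparable with \<open>real n powr (\<gamma> - 1)\<close> for either sign of
  \<open>\<gamma> - 1\<close>.\<close>

lemma increment_lower_bound:
  fixes \<mu> :: "nat \<Rightarrow> real"
  assumes "\<kappa> > 0" "N\<^sub>0 > 0"
    and mono: "\<And>k. k \<ge> 1 \<Longrightarrow> \<mu> k \<le> \<mu> (k + 1)"
    and gap: "\<And>k. k \<ge> N\<^sub>0 \<Longrightarrow> \<mu> (k + 1) - \<mu> k \<ge> \<kappa> * real k powr (\<gamma> - 1)"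
  obtains c where "c > 0"
    and "\<And>m n. 1 \<le> m \<Longrightarrow> m < n \<Longrightarrow> N\<^sub>0 < n \<Longrightarrow>
      c * (real n - real m) * real n powr (\<gamma> - 1) \<le> \<mu> n - \<mu> m"
proof -
  \<comment> \<open>The factor \<open>2\<close> pays for discarding the lower half of the range, the
    power of \<open>2\<close> for the comparison of \<open>k\<close> with \<open>n\<close>.\<close>
  define c where "c = \<kappa> / (2 * 2 powr \<bar>\<gamma> - 1\<bar>)"
  have c: "c > 0" using assms by (simp add: c_def)
  have far: "c * (real n - real m) * real n powr (\<gamma> - 1) \<le> \<mu> n - \<mu> m"
    if mn: "N\<^sub>0 \<le> m" "m < n" for m n
  proof -
    let ?h = "(m + n) div 2"
    have "c * (real n - real m) * real n powr (\<gamma> - 1)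
        = (real n - real m) / 2 * (\<kappa> * (real n powr (\<gamma> - 1) / 2 powr \<bar>\<gamma> - 1\<bar>))"
      by (simp add: c_def)
    also have "\<dots> \<le> real (card {?h..<n}) * (\<kappa> * (real n powr (\<gamma> - 1) / 2 powr \<bar>\<gamma> - 1\<bar>))"
    proof (rule mult_right_mono)
      have "real n - real m \<le> 2 * real (n - ?h)"
        using mn by (simp add: of_nat_diff)
      then show "(real n - real m) / 2 \<le> real (card {?h..<n})" by simp
    qed (use assms in simp)
    also have "\<dots> = (\<Sum>k\<in>{?h..<n}. \<kappa> * (real n powr (\<gamma> - 1) / 2 powr \<bar>\<gamma> - 1\<bar>))"
      by simp
    also have "\<dots> \<le> (\<Sum>k\<in>{?h..<n}. \<kappa> * real k powr (\<gamma> - 1))"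
    proof (rule sum_mono)
      fix k assume k: "k \<in> {?h..<n}"
      \<comment> \<open>Rounding down in \<open>?h\<close> loses at most one in
        \<open>2 * k\<close>, and \<open>m \<ge> 1\<close> makes up for it.\<close>
      have "n \<le> 2 * k" using k mn assms(2) by auto
      then have "real n \<le> 2 * real k" by linarith
      then have "real n powr (\<gamma> - 1) \<le> 2 powr \<bar>\<gamma> - 1\<bar> * real k powr (\<gamma> - 1)"
        using k mn by (intro powr_comparable) auto
      then show "\<kappa> * (real n powr (\<gamma> - 1) / 2 powr \<bar>\<gamma> - 1\<bar>) \<le> \<kappa> * real k powr (\<gamma> - 1)"
        using assms(1) by (intro mult_left_mono) (auto simp: field_simps)
    qed
    also have "\<dots> \<le> (\<Sum>k\<in>{m..<n}. \<kappa> * real k powr (\<gamma> - 1))"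
      using assms(1) mn by (intro sum_mono2) auto
    also have "\<dots> \<le> (\<Sum>k\<in>{m..<n}. \<mu> (Suc k) - \<mu> k)"
      using gap mn by (intro sum_mono) auto
    also have "\<dots> = \<mu> n - \<mu> m"
      using mn by (intro sum_Suc_diff') auto
    finally show ?thesis .
  qed
  have mono': "\<mu> m \<le> \<mu> n" if "m \<le> n" "1 \<le> m" for m n
    using that(1)
  proof (induction n rule: dec_induct)
    case (step k)
    then show ?case using mono[of k] that(2) by simp
  qed simp
  let ?c = "c / (real N\<^sub>0 + 1)"
  show ?thesis
  proof (rule that[of ?c])
    show "?c > 0" using c by simp
    fix m n assume mn: "1 \<le> m" "m < n" "N\<^sub>0 < n"
    let ?m = "max m N\<^sub>0"
    \<comment> \<open>Below \<open>N\<^sub>0\<close> only monotonicity is available, so the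
      increment is counted from \<open>?m\<close>. As \<open>n - N\<^sub>0\<close> is at least
      \<open>1\<close>, the missing at most \<open>N\<^sub>0\<close> steps cost only the factor
      \<open>N\<^sub>0 + 1\<close>.\<close>
    have "real n - real m \<le> (real N\<^sub>0 + 1) * (real n - real ?m)"
    proof (cases "N\<^sub>0 \<le> m")
      case True
      then show ?thesis
        using mn mult_left_mono[of "real m" "real n" "real N\<^sub>0"] by (simp add: algebra_simps)
    next
      case False
      have "real N\<^sub>0 * 1 \<le> real N\<^sub>0 * (real n - real N\<^sub>0)"
        using mn by (intro mult_left_mono) auto
      then show ?thesis using False mn by (simp add: algebra_simps)
    qed
    then have "?c * (real n - real m) \<le> ?c * ((real N\<^sub>0 + 1) * (real n - real ?m))"
      using c by (intro mult_left_mono) auto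
    also have "\<dots> = c * (real n - real ?m)" by simp
    finally have "?c * (real n - real m) * real n powr (\<gamma> - 1)
        \<le> c * (real n - real ?m) * real n powr (\<gamma> - 1)"
      by (intro mult_right_mono) auto
    also have "\<dots> \<le> \<mu> n - \<mu> ?m" using mn by (intro far) auto
    also have "\<dots> \<le> \<mu> n - \<mu> m" using mono'[of m ?m] mn by simp
    finally show "?c * (real n - real m) * real n powr (\<gamma> - 1) \<le> \<mu> n - \<mu> m" .
  qed
qed

section \<open>Integrals over the boundary of a rectangle\<close>

text \<open>The length estimate is applied to the four sides; the last factor is the
  perimeter.\<close>

lemma contour_integral_bound_rectpath:
  assumes int: "f contour_integrable_on rectpath a b" and B: "0 \<le> B"
    and bd: "\<And>z. z \<in> path_image (rectpath a b) \<Longrightarrow> norm (f z) \<le> B"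
  shows "norm (contour_integral (rectpath a b) f) \<le> B * (2 * \<bar>Re (b - a)\<bar> + 2 * \<bar>Im (b - a)\<bar>)"
proof -
  define a2 where "a2 = Complex (Re b) (Im a)"
  define a4 where "a4 = Complex (Re a) (Im b)"
  have r: "rectpath a b = linepath a a2 +++ linepath a2 b +++ linepath b a4 +++ linepath a4 a"
    by (simp add: rectpath_def a2_def a4_def Let_def)
  have i: "f contour_integrable_on linepath a a2" "f contour_integrable_on linepath a2 b"
    "f contour_integrable_on linepath b a4" "f contour_integrable_on linepath a4 a"
    using int unfolding r by (simp_all add: valid_path_join)
  have n: "norm (contour_integral (linepath u v) f) \<le> B * norm (v - u)"
    if "f contour_integrable_on linepath u v" "closed_segment u v \<subseteq> path_image (rectpath a b)" for u v
    using that B bd by (intro contour_integral_bound_linepath) auto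
  have l: "norm (a2 - a) = \<bar>Re (b - a)\<bar>" "norm (b - a2) = \<bar>Im (b - a)\<bar>"
     "norm (a4 - b) = \<bar>Re (b - a)\<bar>" "norm (a - a4) = \<bar>Im (b - a)\<bar>"
    by (simp_all add: a2_def a4_def cmod_def abs_minus_commute)
  have "norm (contour_integral (rectpath a b) f)
     = norm (contour_integral (linepath a a2) f + (contour_integral (linepath a2 b) f +
         (contour_integral (linepath b a4) f + contour_integral (linepath a4 a) f)))"
    unfolding r using i by (simp add: valid_path_join)
  also have "\<dots> \<le> norm (contour_integral (linepath a a2) f) + (norm (contour_integral (linepath a2 b) f) +
         (norm (contour_integral (linepath b a4) f) + norm (contour_integral (linepath a4 a) f)))"
    by (intro order_trans[OF norm_triangle_ineq] add_left_mono order.refl)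
  also have "\<dots> \<le> B * norm (a2 - a) + (B * norm (b - a2) + (B * norm (a4 - b) + B * norm (a - a4)))"
    by (intro add_mono n i) (auto simp: r path_image_join)
  finally show ?thesis unfolding l by (simp add: algebra_simps)
qed

section \<open>The perturbed operator\<close>

text \<open>The coefficient inequality, multiplied by \<open>w k / D k\<close> and summed, gives
  \<open>s \<le> w n / D n + s / 2\<close>. Because \<open>s\<close> is the sum of a convergent
  series, the last term can be absorbed on the left. In the application \<open>U k\<close> is the
  modulus of a resolvent coefficient, \<open>D k\<close> the distance from \<open>z\<close> to
  \<open>\<mu> k\<close>, and \<open>w k\<close> is \<open>real k powr (- \<alpha>)\<close>.\<close>

lemma self_bounding_weighted_sum:
  fixes U w D :: "nat \<Rightarrow> real"
  assumes U: "\<And>k. k \<ge> 1 \<Longrightarrow> 0 \<le> U k" and w: "\<And>k. 0 \<le> w k"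
    and D: "\<And>k. k \<ge> 1 \<Longrightarrow> 0 < D k" and n: "n \<ge> 1"
    and sm: "(\<lambda>k. U k * w k) summable_on {1..}"
    and s: "s = infsum (\<lambda>k. U k * w k) {1..}"
    and le: "\<And>k. k \<ge> 1 \<Longrightarrow> U k * D k \<le> (if k = n then 1 else 0) + M * w k * s"
    and half: "\<And>F. finite F \<Longrightarrow> F \<subseteq> {1..} \<Longrightarrow> (\<Sum>k\<in>F. M * (w k)\<^sup>2 / D k) \<le> 1 / 2"
  shows "s \<le> 2 * w n / D n"
proof -
  have s0: "0 \<le> s" unfolding s by (rule infsum_nonneg) (use U w in auto)
  have "s \<le> w n / D n + s / 2"
    unfolding s
  proof (rule infsum_le_finite_sums[OF sm])
    fix F :: "nat set" assume F: "finite F" "F \<subseteq> {1..}"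
    have "(\<Sum>k\<in>F. U k * w k) \<le> (\<Sum>k\<in>F. (if k = n then w k / D k else 0) + s * (M * (w k)\<^sup>2 / D k))"
    proof (rule sum_mono)
      fix k assume "k \<in> F"
      then have k: "k \<ge> 1" using F by auto
      have "U k \<le> ((if k = n then 1 else 0) + M * w k * s) / D k"
        using le[OF k] D[OF k] by (simp add: pos_le_divide_eq)
      then have "U k * w k \<le> ((if k = n then 1 else 0) + M * w k * s) / D k * w k"
        using w by (intro mult_right_mono) auto
      also have "\<dots> = (if k = n then w k / D k else 0) + s * (M * (w k)\<^sup>2 / D k)"
        by (auto simp: add_divide_distrib power2_eq_square algebra_simps)
      finally show "U k * w k \<le> (if k = n then w k / D k else 0) + s * (M * (w k)\<^sup>2 / D k)" .
    qed
    also have "\<dots> = (if n \<in> F then w n / D n else 0) + s * (\<Sum>k\<in>F. M * (w k)\<^sup>2 / D k)"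
      using F by (simp add: sum.distrib sum_distrib_left)
    also have "\<dots> \<le> w n / D n + s * (1 / 2)"
      using half[OF F] s0 w[of n] D[OF n] by (intro add_mono mult_left_mono) auto
    finally show "(\<Sum>k\<in>F. U k * w k) \<le> w n / D n + (\<Sum>\<^sub>\<infinity>k\<in>{1..}. U k * w k) / 2"
      by (simp add: s)
  qed
  then show ?thesis by simp
qed

lemma resolvent_graph: "z \<in> resolvent_set T \<Longrightarrow> (resolvent T z y, z *\<^sub>C resolvent T z y - y) \<in> T"
  unfolding resolvent_set_def resolvent_def by (rule theI') simp

text \<open>The junk value of \<^const>\<open>integral\<close> at non-integrable functions is \<open>0\<close>, so a nonzero
  Riesz vector already guarantees that the resolvent is integrable along the path.\<close>

lemma cinner_Riesz_vector:
  assumes "Riesz_vector T g x \<noteq> 0"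
  shows "((\<lambda>z. cinner (resolvent T z x) y) has_contour_integral
    (2 * complex_of_real pi * \<i>) * cinner (Riesz_vector T g x) y) g"
proof -
  let ?f = "\<lambda>s. vector_derivative g (at s within {0..1}) *\<^sub>C resolvent T (g s) x"
  have "?f integrable_on {0..1}"
    using assms not_integrable_integral[of ?f "{0..1}"]
    by (auto simp: Riesz_vector_def vcontour_integral_def)
  then have "(?f has_integral vcontour_integral g (\<lambda>z. resolvent T z x)) {0..1}"
    unfolding vcontour_integral_def by (rule integrable_integral)
  then have "((\<lambda>v. cinner v y) \<circ> ?f has_integral
      cinner (vcontour_integral g (\<lambda>z. resolvent T z x)) y) {0..1}"
    by (rule has_integral_linear[OF _ bounded_linear_cinner_left])
  moreover have "cinner (vcontour_integral g (\<lambda>z. resolvent T z x)) y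
      = (2 * complex_of_real pi * \<i>) * cinner (Riesz_vector T g x) y"
    by (simp add: Riesz_vector_def cinner_scaleC_left)
  ultimately show ?thesis
    by (simp add: has_contour_integral_def o_def cinner_scaleC_left mult.commute)
qed

section \<open>Standing data and first facts on the eigenvectors\<close>

text \<open>The V-norm appears as the norm of \<open>op_app S\<close>, and \<open>C\<^sub>b\<close>
  is a fixed witness for the continuity of \<open>b\<close>. The two alternatives of the theorem's
  hypothesis are merged into the single inequality \<open>exponents\<close>.\<close>

locale form_perturbation =
  fixes V :: "'h::chilbert_space set"
    and a b :: "'h \<Rightarrow> 'h \<Rightarrow> complex"
    and S :: "('h \<times> 'h) set"
    and \<mu> :: "nat \<Rightarrow> real" and \<psi> :: "nat \<Rightarrow> 'h"
    and \<gamma> \<kappa> \<alpha> M C\<^sub>b :: real and N\<^sub>0 :: nat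
  assumes a_sesquilinear: "sesquilinear_on V a"
    and a_hermitian: "hermitian_on V a"
    and a_positive: "positive_definite_on V a"
    and S_sqrt: "is_sqrt_op S (form_op V a)"
    and basis: "orthonormal_basis \<psi>"
    and eigenvector: "\<And>k. k \<ge> 1 \<Longrightarrow> (\<psi> k, complex_of_real (\<mu> k) *\<^sub>C \<psi> k) \<in> form_op V a"
    and mu_1_pos: "0 < \<mu> 1"
    and mu_mono: "\<And>k. k \<ge> 1 \<Longrightarrow> \<mu> k \<le> \<mu> (k + 1)"
    and b_sesquilinear: "sesquilinear_on V b"
    and b_continuous: "\<And>u v. u \<in> V \<Longrightarrow> v \<in> V \<Longrightarrow>
      cmod (b u v) \<le> C\<^sub>b * norm (op_app S u) * norm (op_app S v)"
    and gamma_pos: "\<gamma> > 0" and kappa_pos: "\<kappa> > 0" and N0_pos: "N\<^sub>0 > 0" and M_pos: "M > 0"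
    and gap: "\<And>k. k \<ge> N\<^sub>0 \<Longrightarrow> \<mu> (k + 1) - \<mu> k \<ge> \<kappa> * real k powr (\<gamma> - 1)"
    and exponents: "2 * \<alpha> + \<gamma> > 3 / 2"
    and b_bound: "\<And>m n. m \<ge> 1 \<Longrightarrow> n \<ge> 1 \<Longrightarrow>
      cmod (b (\<psi> m) (\<psi> n)) \<le> M * real m powr (- \<alpha>) * real n powr (- \<alpha>)"
begin

lemma S_self_adjoint: "self_adjoint S"
  using S_sqrt by (simp add: is_sqrt_op_def)

lemma adjoint_S: "adjoint_op S = S"
  using S_self_adjoint by (simp add: self_adjoint_def)

lemma V_subspace: "complex_vector.subspace V"
  using a_sesquilinear by (simp add: sesquilinear_on_def)

lemma psi_in_V: "k \<ge> 1 \<Longrightarrow> \<psi> k \<in> V"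
  using eigenvector by (simp add: form_op_def)

lemma mu_mono_le: "m \<le> n \<Longrightarrow> 1 \<le> m \<Longrightarrow> \<mu> m \<le> \<mu> n"
proof (induction n rule: dec_induct)
  case (step k)
  then show ?case using mu_mono[of k] by simp
qed simp

lemma mu_pos: "k \<ge> 1 \<Longrightarrow> 0 < \<mu> k"
  using mu_mono_le[of 1 k] mu_1_pos by simp

lemma S_psi: "k \<ge> 1 \<Longrightarrow> (\<psi> k, complex_of_real (sqrt (\<mu> k)) *\<^sub>C \<psi> k) \<in> S"
  by (rule sqrt_op_eigenvector[OF S_sqrt eigenvector mu_pos])

section \<open>Expansion in \<open>V\<close> and the action of the forms on coefficients\<close>

text \<open>Bessel's inequality for \<open>a\<close> makes the formal series for the image of
  \<open>u\<close> under \<open>S\<close> converge to some \<open>w\<close>. Closedness of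
  \<open>S\<close> then puts \<open>(u, w)\<close> into its graph, which in particular shows that
  \<open>V\<close> lies in the domain of \<open>S\<close>. The second claim is convergence of the
  eigenvector expansion in the V-norm.\<close>

lemma S_expansion:
  assumes "u \<in> V"
  shows "\<And>m. m \<ge> 1 \<Longrightarrow> cinner (op_app S u) (\<psi> m) = complex_of_real (sqrt (\<mu> m)) * cinner u (\<psi> m)"
    and "(\<lambda>K. op_app S (u - (\<Sum>k\<in>{1..K}. cinner u (\<psi> k) *\<^sub>C \<psi> k))) \<longlonglongrightarrow> 0"
proof -
  let ?c = "\<lambda>k. complex_of_real (sqrt (\<mu> k)) * cinner u (\<psi> k)"
  have "(\<Sum>k\<in>{1..K}. (cmod (?c k))\<^sup>2) \<le> Re (a u u)" for K
  proof -
    have "(\<Sum>k\<in>{1..K}. (cmod (?c k))\<^sup>2) = (\<Sum>k\<in>{1..K}. \<mu> k * (cmod (cinner u (\<psi> k)))\<^sup>2)"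
      by (rule sum.cong) (use mu_pos in \<open>auto simp: norm_mult power_mult_distrib less_imp_le\<close>)
    then show ?thesis
      using form_bessel_inequality[OF basis a_sesquilinear a_hermitian a_positive eigenvector assms]
      by simp
  qed
  then obtain w where w: "(\<lambda>K. \<Sum>k\<in>{1..K}. ?c k *\<^sub>C \<psi> k) \<longlonglongrightarrow> w"
      "\<And>m. m \<ge> 1 \<Longrightarrow> cinner w (\<psi> m) = ?c m"
    by (rule orthogonal_series_converges[OF basis, of ?c "Re (a u u)"]) blast
  have p: "(\<Sum>k\<in>{1..K}. cinner u (\<psi> k) *\<^sub>C \<psi> k, \<Sum>k\<in>{1..K}. ?c k *\<^sub>C \<psi> k) \<in> adjoint_op S" for K
  proof (rule adjoint_op_sum)
    fix k assume "k \<in> {1..K}"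
    then have "(\<psi> k, complex_of_real (sqrt (\<mu> k)) *\<^sub>C \<psi> k) \<in> adjoint_op S"
      using S_psi[of k] by (simp add: adjoint_S)
    from adjoint_op_scaleC[OF this, of "cinner u (\<psi> k)"]
    show "(cinner u (\<psi> k) *\<^sub>C \<psi> k, ?c k *\<^sub>C \<psi> k) \<in> adjoint_op S"
      by (simp add: scaleC_scaleC mult.commute)
  qed
  have uw: "(u, w) \<in> adjoint_op S"
    by (rule adjoint_op_closed[OF p basis_expansion[OF basis] w(1)])
  then have "op_app S u = w"
    by (intro op_app_eq S_self_adjoint) (simp add: adjoint_S)
  then show "\<And>m. m \<ge> 1 \<Longrightarrow> cinner (op_app S u) (\<psi> m) = ?c m"
    using w(2) by simp
  have "op_app S (u - (\<Sum>k\<in>{1..K}. cinner u (\<psi> k) *\<^sub>C \<psi> k)) = w - (\<Sum>k\<in>{1..K}. ?c k *\<^sub>C \<psi> k)" for K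
    using adjoint_op_diff[OF uw p] by (intro op_app_eq S_self_adjoint) (simp add: adjoint_S)
  then show "(\<lambda>K. op_app S (u - (\<Sum>k\<in>{1..K}. cinner u (\<psi> k) *\<^sub>C \<psi> k))) \<longlonglongrightarrow> 0"
    using tendsto_diff[OF tendsto_const w(1), of w] by simp
qed

text \<open>Hermitian symmetry brings \<open>\<psi> m\<close> into the first slot of
  \<open>a\<close>, where its eigenvector equation evaluates the form.\<close>

lemma resolvent_equation_coefficient:
  assumes "(u, z *\<^sub>C u - y) \<in> form_op V (\<lambda>u v. a u v + b u v)" "m \<ge> 1"
  shows "(z - of_real (\<mu> m)) * cinner u (\<psi> m) = cinner y (\<psi> m) + b u (\<psi> m)"
proof -
  have u: "u \<in> V" using assms(1) by (simp add: form_op_def)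
  have "a u (\<psi> m) = cnj (a (\<psi> m) u)"
    using a_hermitian u psi_in_V[OF assms(2)] unfolding hermitian_on_def by blast
  also have "a (\<psi> m) u = of_real (\<mu> m) * cinner (\<psi> m) u"
    using eigenvector[OF assms(2)] u by (simp add: form_op_def cinner_scaleC_left)
  finally have 1: "a u (\<psi> m) = of_real (\<mu> m) * cinner u (\<psi> m)"
    by (simp add: cinner_commute[of u "\<psi> m"])
  have "a u (\<psi> m) + b u (\<psi> m) = cinner (z *\<^sub>C u - y) (\<psi> m)"
    using assms(1) psi_in_V[OF assms(2)] unfolding form_op_def by blast
  then show ?thesis
    by (simp add: 1 cinner_diff_left cinner_scaleC_left algebra_simps)
qed

text \<open>A symmetric version of \<open>increment_lower_bound\<close>: the larger of the two
  indices governs the power, and it exceeds \<open>N\<^sub>0\<close> as soon as \<open>n\<close>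
  does.\<close>

lemma gap_lower_bound:
  obtains c where "c > 0"
    and "\<And>m n. m \<ge> 1 \<Longrightarrow> m \<noteq> n \<Longrightarrow> n > N\<^sub>0 \<Longrightarrow>
      c * \<bar>real m - real n\<bar> * max (real m) (real n) powr (\<gamma> - 1) \<le> \<bar>\<mu> m - \<mu> n\<bar>"
    and "\<And>n. n > N\<^sub>0 \<Longrightarrow> c * real n powr \<gamma> \<le> \<mu> n"
proof -
  obtain c where c: "c > 0" "\<And>m n. 1 \<le> m \<Longrightarrow> m < n \<Longrightarrow> N\<^sub>0 < n \<Longrightarrow>
      c * (real n - real m) * real n powr (\<gamma> - 1) \<le> \<mu> n - \<mu> m"
    by (rule increment_lower_bound[OF kappa_pos N0_pos mu_mono gap]) (assumption, assumption, rule that)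
  show ?thesis
  \<comment> \<open>Halving \<open>c\<close> serves the growth bound: comparing
    \<open>\<mu> n\<close> with \<open>\<mu> 1\<close> yields \<open>n - 1\<close> steps, and
    \<open>n - 1 \<ge> n / 2\<close> because \<open>n \<ge> 2\<close>.\<close>
  proof (rule that[of "c / 2"])
    fix m n assume mn: "m \<ge> 1" "m \<noteq> n" "n > N\<^sub>0"
    have "c * \<bar>real m - real n\<bar> * max (real m) (real n) powr (\<gamma> - 1) \<le> \<bar>\<mu> m - \<mu> n\<bar>"
    proof (cases "m < n")
      case True
      then show ?thesis using c(2)[of m n] mn(1,3) by (simp add: max_def)
    next
      case False
      then show ?thesis using c(2)[of n m] mn N0_pos by (simp add: max_def)
    qed
    moreover have "0 \<le> c * \<bar>real m - real n\<bar> * max (real m) (real n) powr (\<gamma> - 1)"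
      using c(1) by simp
    ultimately show "c / 2 * \<bar>real m - real n\<bar> * max (real m) (real n) powr (\<gamma> - 1) \<le> \<bar>\<mu> m - \<mu> n\<bar>"
      by simp
  next
    fix n assume n: "n > N\<^sub>0"
    have "c / 2 * real n powr \<gamma> = c * (real n / 2) * real n powr (\<gamma> - 1)"
      using n powr_add[of "real n" 1 "\<gamma> - 1"] by simp
    also have "\<dots> \<le> c * (real n - real 1) * real n powr (\<gamma> - 1)"
      using c(1) n N0_pos by (intro mult_right_mono mult_left_mono) auto
    also have "\<dots> \<le> \<mu> n - \<mu> 1" using n N0_pos by (intro c(2)) auto
    finally show "c / 2 * real n powr \<gamma> \<le> \<mu> n" using mu_1_pos by simp
  qed (use c in simp)
qed

text \<open>Young's inequality with weight \<open>\<mu> k\<close> splits the term into a part of the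
  series for \<open>a u u\<close> and \<open>real k powr (- (2 * \<alpha>)) / \<mu> k\<close>. By
  the growth of \<open>\<mu>\<close> the latter is of order
  \<open>real k powr (- (2 * \<alpha> + \<gamma>))\<close>, with
  \<open>2 * \<alpha> + \<gamma> > 1\<close>.\<close>

lemma weighted_coefficients_summable:
  assumes "u \<in> V"
  shows "(\<lambda>k. cmod (cinner u (\<psi> k)) * real k powr (- \<alpha>)) summable_on {1..}"
proof -
  obtain c where c: "c > 0" "\<And>n. n > N\<^sub>0 \<Longrightarrow> c * real n powr \<gamma> \<le> \<mu> n"
    by (rule gap_lower_bound) (rule that)
  let ?f = "\<lambda>k. \<mu> k * (cmod (cinner u (\<psi> k)))\<^sup>2"
  \<comment> \<open>Data at index \<open>0\<close> are arbitrary, so the bounded partial sums are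
    those of the shifted series.\<close>
  have "summable (\<lambda>k. ?f (Suc k))"
  proof (rule summableI_nonneg_bounded)
    show "(\<Sum>k<n. ?f (Suc k)) \<le> Re (a u u)" for n
      using form_bessel_inequality[OF basis a_sesquilinear a_hermitian a_positive eigenvector assms, of n]
      by (simp add: sum.atLeast1_atMost_eq)
  qed (use mu_pos in \<open>simp add: less_imp_le\<close>)
  then have 1: "summable ?f" by (rule summable_Suc_iff[THEN iffD1])
  have 2: "summable (\<lambda>k. real k powr (- (2 * \<alpha> + \<gamma>)) / c)"
    using exponents by (intro summable_divide) (simp add: summable_real_powr_iff)
  have "summable (\<lambda>k. cmod (cinner u (\<psi> k)) * real k powr (- \<alpha>))"
  proof (rule summable_comparison_test_ev)
    show "\<forall>\<^sub>F k in sequentially. norm (cmod (cinner u (\<psi> k)) * real k powr (- \<alpha>))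
        \<le> ?f k + real k powr (- (2 * \<alpha> + \<gamma>)) / c"
      using eventually_gt_at_top[of N\<^sub>0]
    proof eventually_elim
      case (elim k)
      let ?x = "cmod (cinner u (\<psi> k))" let ?y = "real k powr (- \<alpha>)"
      have k: "real k > 0" and m: "\<mu> k > 0" using elim N0_pos mu_pos[of k] by auto
      have "0 \<le> (\<mu> k * ?x - ?y)\<^sup>2 / \<mu> k" using m by simp
      also have "\<dots> = ?f k - 2 * (?x * ?y) + ?y\<^sup>2 / \<mu> k"
        using m by (simp add: power2_eq_square field_simps)
      finally have "2 * (?x * ?y) \<le> ?f k + ?y\<^sup>2 / \<mu> k" by simp
      moreover have "0 \<le> ?x * ?y" by simp
      moreover have "?y\<^sup>2 / \<mu> k \<le> ?y\<^sup>2 / (c * real k powr \<gamma>)"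
        using c elim k m by (intro divide_left_mono) auto
      moreover have "?y\<^sup>2 / (c * real k powr \<gamma>) = real k powr (- (2 * \<alpha> + \<gamma>)) / c"
      proof -
        have "real k powr (- (2 * \<alpha> + \<gamma>)) * real k powr \<gamma> = ?y\<^sup>2"
          by (simp add: power2_eq_square powr_add[symmetric])
        then show ?thesis using c(1) k by (simp add: field_simps)
      qed
      ultimately have "?x * ?y \<le> ?f k + real k powr (- (2 * \<alpha> + \<gamma>)) / c" by linarith
      then show ?case by simp
    qed
  qed (intro summable_add 1 2)
  then have "(\<lambda>k. cmod (cinner u (\<psi> k)) * real k powr (- \<alpha>)) summable_on UNIV"
    by (subst summable_on_UNIV_nonneg_real_iff) auto
  then show ?thesis by (rule summable_on_subset_banach) simp
qed

text \<open>For partial sums of the expansion of \<open>u\<close> the triangle inequality and the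
  matrix bound on \<open>b\<close> suffice. Continuity of \<open>b\<close> in the V-norm carries the
  estimate to \<open>u\<close>.\<close>

lemma b_weighted_bound:
  assumes u: "u \<in> V" and m: "m \<ge> 1"
  shows "cmod (b u (\<psi> m))
    \<le> M * real m powr (- \<alpha>) * infsum (\<lambda>k. cmod (cinner u (\<psi> k)) * real k powr (- \<alpha>)) {1..}"
    (is "_ \<le> _ * ?s")
proof -
  let ?p = "\<lambda>K. \<Sum>k\<in>{1..K}. cinner u (\<psi> k) *\<^sub>C \<psi> k"
  have pm: "\<psi> m \<in> V" by (rule psi_in_V[OF m])
  have b: "b (x + y) (\<psi> m) = b x (\<psi> m) + b y (\<psi> m)"
    "b (c *\<^sub>C x) (\<psi> m) = c * b x (\<psi> m)" if "x \<in> V" "y \<in> V" for x y c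
    using b_sesquilinear pm that unfolding sesquilinear_on_def by blast+
  have b0: "b 0 (\<psi> m) = 0"
    using b(2)[OF u u, of 0] by simp
  have sV: "c *\<^sub>C \<psi> k \<in> V" if "k \<ge> 1" for c k
    using V_subspace psi_in_V[OF that] complex_vector.subspace_scale by blast
  have p: "?p K \<in> V \<and> b (?p K) (\<psi> m) = (\<Sum>k\<in>{1..K}. cinner u (\<psi> k) * b (\<psi> k) (\<psi> m))" for K
  proof (induction K)
    case 0
    then show ?case using b0 complex_vector.subspace_0[OF V_subspace] by simp
  next
    case (Suc K)
    have s: "cinner u (\<psi> (Suc K)) *\<^sub>C \<psi> (Suc K) \<in> V" by (rule sV) simp
    have e: "?p (Suc K) = ?p K + cinner u (\<psi> (Suc K)) *\<^sub>C \<psi> (Suc K)" by simp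
    show ?case unfolding e
      using Suc s complex_vector.subspace_add[OF V_subspace] b(1)[OF _ s] b(2)[of "\<psi> (Suc K)"] psi_in_V
      by simp
  qed
  have le: "cmod (b (?p K) (\<psi> m)) \<le> M * real m powr (- \<alpha>) * ?s" for K
  proof -
    have "cmod (b (?p K) (\<psi> m)) \<le> (\<Sum>k\<in>{1..K}. cmod (cinner u (\<psi> k)) * cmod (b (\<psi> k) (\<psi> m)))"
      using p by (simp add: norm_mult sum_norm_le)
    also have "\<dots> \<le> (\<Sum>k\<in>{1..K}. cmod (cinner u (\<psi> k)) * (M * real k powr (- \<alpha>) * real m powr (- \<alpha>)))"
      using b_bound m by (intro sum_mono mult_left_mono) auto
    also have "\<dots> = M * real m powr (- \<alpha>) * (\<Sum>k\<in>{1..K}. cmod (cinner u (\<psi> k)) * real k powr (- \<alpha>))"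
      by (simp add: sum_distrib_left mult_ac)
    also have "\<dots> \<le> M * real m powr (- \<alpha>) * ?s"
      using M_pos
      by (intro mult_left_mono finite_sum_le_infsum weighted_coefficients_summable u) auto
    finally show ?thesis .
  qed
  \<comment> \<open>Convergence of \<open>?p K\<close> to \<open>u\<close> in \<open>H\<close> alone
    would not be enough here; \<open>S_expansion\<close> supplies convergence in the V-norm.\<close>
  have "(\<lambda>K. b (u - ?p K) (\<psi> m)) \<longlonglongrightarrow> 0"
  proof (rule Lim_null_comparison)
    show "\<forall>\<^sub>F K in sequentially. norm (b (u - ?p K) (\<psi> m))
        \<le> C\<^sub>b * norm (op_app S (u - ?p K)) * norm (op_app S (\<psi> m))"
      using p u pm complex_vector.subspace_diff[OF V_subspace]
      by (intro always_eventually allI b_continuous) auto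
    show "(\<lambda>K. C\<^sub>b * norm (op_app S (u - ?p K)) * norm (op_app S (\<psi> m))) \<longlonglongrightarrow> 0"
      using S_expansion(2)[OF u]
      by (intro tendsto_mult_left_zero tendsto_mult_right_zero tendsto_norm_zero)
  qed
  moreover have "b u (\<psi> m) - b (u - ?p K) (\<psi> m) = b (?p K) (\<psi> m)" for K
    using b(1)[of "u - ?p K" "?p K"] p[of K] u complex_vector.subspace_diff[OF V_subspace] by simp
  ultimately have "(\<lambda>K. b (?p K) (\<psi> m)) \<longlonglongrightarrow> b u (\<psi> m)"
    using tendsto_diff[OF tendsto_const, of "\<lambda>K. b (u - ?p K) (\<psi> m)" 0 sequentially "b u (\<psi> m)"] by simp
  then have "(\<lambda>K. cmod (b (?p K) (\<psi> m))) \<longlonglongrightarrow> cmod (b u (\<psi> m))"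
    by (rule tendsto_norm)
  then show ?thesis by (rule LIMSEQ_le_const2) (use le in blast)
qed

section \<open>Kernel sums over the eigenvalues\<close>

text \<open>The first sum makes the absorption argument work for large \<open>n\<close>. The second
  bounds, up to a constant, the off-diagonal part of the \<open>n\<close>-th term of the theorem's
  series; \<open>p > 1\<close> lets it be summed over \<open>n\<close>.\<close>

lemma kernel_sum_bounds:
  obtains C \<epsilon> p where "C > 0" "\<epsilon> > 0" "p > 1" "p \<le> 2 * (2 * \<alpha> + \<gamma> - 1)"
    and "\<And>n F. n > N\<^sub>0 \<Longrightarrow> finite F \<Longrightarrow> F \<subseteq> {1..} - {n} \<Longrightarrow>
      (\<Sum>m\<in>F. real m powr (- (2 * \<alpha>)) / \<bar>\<mu> m - \<mu> n\<bar>) \<le> C * real n powr (- \<epsilon>)"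
    and "\<And>n F. n > N\<^sub>0 \<Longrightarrow> finite F \<Longrightarrow> F \<subseteq> {1..} - {n} \<Longrightarrow>
      (\<Sum>m\<in>F. \<mu> m / \<mu> n * (real m powr (- \<alpha>) * real n powr (- \<alpha>) / \<bar>\<mu> m - \<mu> n\<bar>)\<^sup>2)
        \<le> C * real n powr (- p)"
proof -
  define \<delta> where "\<delta> = 2 * \<alpha> + \<gamma> - 1"
  have d: "\<delta> > 1 / 2" using exponents by (simp add: \<delta>_def)
  \<comment> \<open>The caps by \<open>\<delta> / 2\<close> and \<open>1 + \<delta> / 2\<close>
    together give \<open>p \<le> 2 * \<alpha> + \<gamma> - \<epsilon>\<close>, as the first kernel
    requires; \<open>2\<close> and \<open>2 * \<delta>\<close> are the caps for the second. That
    \<open>p\<close> can exceed \<open>1\<close> rests on \<open>\<delta> > 1 / 2\<close>.\<close>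
  define \<epsilon> where "\<epsilon> = min \<gamma> (\<delta> / 2)"
  define p where "p = min 2 (min (1 + \<delta> / 2) (2 * \<delta>))"
  have e: "0 < \<epsilon>" "\<epsilon> \<le> \<gamma>" "\<epsilon> \<le> \<delta> / 2" using d gamma_pos by (auto simp: \<epsilon>_def)
  have p: "p > 1" "p \<le> 2" "p \<le> 1 + \<delta> / 2" "p \<le> 2 * \<delta>" using d by (auto simp: p_def)
  have pe: "p \<le> 2 * \<alpha> + \<gamma> - \<epsilon>" using p(3) e(3) \<delta>_def by linarith
  obtain c where c: "c > 0"
    "\<And>m n. m \<ge> 1 \<Longrightarrow> m \<noteq> n \<Longrightarrow> n > N\<^sub>0 \<Longrightarrow>
      c * \<bar>real m - real n\<bar> * max (real m) (real n) powr (\<gamma> - 1) \<le> \<bar>\<mu> m - \<mu> n\<bar>"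
    "\<And>n. n > N\<^sub>0 \<Longrightarrow> c * real n powr \<gamma> \<le> \<mu> n"
    by (rule gap_lower_bound) (rule that)
  obtain Z where Z: "Z > 0" "\<And>(n::nat) F. finite F \<Longrightarrow> F \<subseteq> {1..} - {n} \<Longrightarrow>
      (\<Sum>m\<in>F. real m powr (- p) + \<bar>real m - real n\<bar> powr (- p)) \<le> Z"
    by (rule sum_powr_translate_bound[OF p(1)]) (rule that)
  define A where "A = (2 + 2 powr \<bar>1 - \<gamma>\<bar> * 2 powr \<epsilon>) / c"
  define B where "B = (4 + 2 powr \<bar>2 * \<alpha>\<bar> * 2 powr \<bar>2 - 2 * \<gamma>\<bar>) / c\<^sup>2"
  have A: "A > 0" and B: "B > 0" using c(1) by (auto simp: A_def B_def add_pos_nonneg)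
  have first: "real m powr (- (2 * \<alpha>)) / \<bar>\<mu> m - \<mu> n\<bar>
      \<le> A * real n powr (- \<epsilon>) * (real m powr (- p) + \<bar>real m - real n\<bar> powr (- p))"
    and second: "real n powr (- (2 * \<alpha>)) * real m powr (- (2 * \<alpha>)) / \<bar>\<mu> m - \<mu> n\<bar>\<^sup>2
      \<le> B * real n powr (- p) * (real m powr (- p) + \<bar>real m - real n\<bar> powr (- p))"
    and Dpos: "0 < \<bar>\<mu> m - \<mu> n\<bar>"
    if mn: "m \<ge> 1" "m \<noteq> n" "n > N\<^sub>0" for m n
  proof -
    let ?M = "max (real m) (real n)" let ?d = "\<bar>real m - real n\<bar>" let ?D = "\<bar>\<mu> m - \<mu> n\<bar>"
    have M: "?M > 0" and d1: "?d \<ge> 1" and n1: "1 \<le> real n" and m1: "1 \<le> real m"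
      using mn by auto
    have D: "c * ?d * ?M powr (\<gamma> - 1) \<le> ?D" using c(2)[OF mn] .
    have pos: "0 < c * ?d * ?M powr (\<gamma> - 1)" using c(1) d1 M by (intro mult_pos_pos) auto
    then show Dp: "0 < ?D" using D by simp
    have inv: "?M powr (1 - \<gamma>) * ?M powr (\<gamma> - 1) = 1"
      using M by (simp add: powr_add[symmetric])
    \<comment> \<open>Replacing the spectral distance by its lower bound in the indices reduces both
      estimates to the two power kernels, the second one after squaring.\<close>
    have "1 / ?D \<le> 1 / (c * ?d * ?M powr (\<gamma> - 1))"
      using D pos by (intro divide_left_mono) auto
    also have "\<dots> = ?M powr (1 - \<gamma>) / ?d / c"
      using inv pos d1 c(1) M by (simp add: field_simps)
    finally have 1: "1 / ?D \<le> ?M powr (1 - \<gamma>) / ?d / c" .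
    have "real m powr (- (2 * \<alpha>)) / ?D = real m powr (- (2 * \<alpha>)) * (1 / ?D)" by simp
    also have "\<dots> \<le> real m powr (- (2 * \<alpha>)) * (?M powr (1 - \<gamma>) / ?d / c)"
      using 1 by (intro mult_left_mono) auto
    also have "\<dots> = (real m powr (- (2 * \<alpha>)) * ?M powr (1 - \<gamma>) / ?d) / c" by simp
    also have "\<dots> \<le> ((2 + 2 powr \<bar>1 - \<gamma>\<bar> * 2 powr \<epsilon>) * real n powr (- \<epsilon>)
        * (real m powr (- p) + ?d powr (- p))) / c"
      using c(1) e p pe d1 n1 m1 by (intro divide_right_mono first_kernel_bound) auto
    finally show "real m powr (- (2 * \<alpha>)) / ?D
      \<le> A * real n powr (- \<epsilon>) * (real m powr (- p) + ?d powr (- p))"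
      by (simp add: A_def)
    have "(1 / ?D)\<^sup>2 \<le> (?M powr (1 - \<gamma>) / ?d / c)\<^sup>2"
      using 1 by (intro power_mono) auto
    also have "\<dots> = ?M powr (2 - 2 * \<gamma>) / ?d\<^sup>2 / c\<^sup>2"
      by (simp add: power_divide power_mult_distrib power2_eq_square[of "_ powr _"] powr_add[symmetric])
    finally have 2: "1 / ?D\<^sup>2 \<le> ?M powr (2 - 2 * \<gamma>) / ?d\<^sup>2 / c\<^sup>2"
      by (simp add: power_divide)
    have "real n powr (- (2 * \<alpha>)) * real m powr (- (2 * \<alpha>)) / ?D\<^sup>2
        = real n powr (- (2 * \<alpha>)) * real m powr (- (2 * \<alpha>)) * (1 / ?D\<^sup>2)" by simp
    also have "\<dots> \<le> real n powr (- (2 * \<alpha>)) * real m powr (- (2 * \<alpha>)) * (?M powr (2 - 2 * \<gamma>) / ?d\<^sup>2 / c\<^sup>2)"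
      using 2 by (intro mult_left_mono) auto
    also have "\<dots> = (real n powr (- (2 * \<alpha>)) * real m powr (- (2 * \<alpha>)) * ?M powr (2 - 2 * \<gamma>) / ?d\<^sup>2) / c\<^sup>2"
      by simp
    also have "\<dots> \<le> ((4 + 2 powr \<bar>2 * \<alpha>\<bar> * 2 powr \<bar>2 - 2 * \<gamma>\<bar>) * real n powr (- p)
        * (real m powr (- p) + ?d powr (- p))) / c\<^sup>2"
      using gamma_pos p d1 n1 m1 \<delta>_def d by (intro divide_right_mono second_kernel_bound) auto
    finally show "real n powr (- (2 * \<alpha>)) * real m powr (- (2 * \<alpha>)) / ?D\<^sup>2
      \<le> B * real n powr (- p) * (real m powr (- p) + ?d powr (- p))"
      by (simp add: B_def)
  qed
  \<comment> \<open>The weight satisfies \<open>\<mu> m / \<mu> n \<le> 1 + \<bar>\<mu> m - \<mu>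
    n\<bar> / \<mu> n\<close>. The \<open>1\<close> leaves the second kernel. The other summand
    cancels one power of the distance and leaves the first kernel times
    \<open>real n powr (- (2 * \<alpha>)) / \<mu> n\<close>, which is at most
    \<open>real n powr (- p) / c\<close>.\<close>
  have third: "\<mu> m / \<mu> n * (real m powr (- \<alpha>) * real n powr (- \<alpha>) / \<bar>\<mu> m - \<mu> n\<bar>)\<^sup>2
      \<le> (B + A / c) * real n powr (- p) * (real m powr (- p) + \<bar>real m - real n\<bar> powr (- p))"
    if mn: "m \<ge> 1" "m \<noteq> n" "n > N\<^sub>0" for m n
  proof -
    let ?D = "\<bar>\<mu> m - \<mu> n\<bar>" let ?w = "real m powr (- p) + \<bar>real m - real n\<bar> powr (- p)"
    let ?x = "real m powr (- (2 * \<alpha>))" let ?y = "real n powr (- (2 * \<alpha>))"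
    have mu: "\<mu> n > 0" "\<mu> m > 0" and D: "?D > 0" and n1: "1 \<le> real n" and w: "?w \<ge> 0"
      using mn mu_pos[of n] mu_pos[of m] Dpos[OF mn] by auto
    have xy: "(real m powr (- \<alpha>) * real n powr (- \<alpha>))\<^sup>2 = ?y * ?x"
    proof -
      have "(r powr (- \<alpha>))\<^sup>2 = r powr (- (2 * \<alpha>))" for r :: real
        by (simp add: power2_eq_square powr_add[symmetric])
      then show ?thesis by (simp add: power_mult_distrib)
    qed
    have "\<mu> m / \<mu> n * (real m powr (- \<alpha>) * real n powr (- \<alpha>) / ?D)\<^sup>2
        \<le> (1 + ?D / \<mu> n) * (real m powr (- \<alpha>) * real n powr (- \<alpha>) / ?D)\<^sup>2"
      using mu by (intro mult_right_mono) (auto simp: field_simps abs_if)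
    also have "\<dots> = (1 + ?D / \<mu> n) * (?y * ?x / ?D\<^sup>2)"
      by (simp only: power_divide xy)
    also have "\<dots> = ?y * ?x / ?D\<^sup>2 + ?y / \<mu> n * (?x / ?D)"
    proof -
      have "(1 + D / k) * (y * x / D\<^sup>2) = y * x / D\<^sup>2 + y / k * (x / D)" if "D > 0" "k > 0" for D k x y :: real
        using that by (simp add: field_simps power2_eq_square)
      from this[OF D mu(1)] show ?thesis .
    qed
    also have "\<dots> \<le> B * real n powr (- p) * ?w + (real n powr (- p) / c) * (A * 1 * ?w)"
    proof (rule add_mono[OF second[OF mn] mult_mono])
      have "?y / \<mu> n \<le> ?y / (c * real n powr \<gamma>)"
        using c(1) c(3)[OF mn(3)] mu n1 by (intro divide_left_mono) auto
      also have "\<dots> = real n powr (- (2 * \<alpha> + \<gamma>)) / c"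
      proof -
        have "real n powr (- (2 * \<alpha> + \<gamma>)) * real n powr \<gamma> = ?y"
          by (simp add: powr_add[symmetric])
        then show ?thesis using c(1) n1 by (simp add: field_simps)
      qed
      also have "\<dots> \<le> real n powr (- p) / c"
        using c(1) p d n1 by (intro divide_right_mono powr_mono) (auto simp: \<delta>_def)
      finally show "?y / \<mu> n \<le> real n powr (- p) / c" .
      have "A * real n powr (- \<epsilon>) * ?w \<le> A * 1 * ?w"
      proof (intro mult_right_mono mult_left_mono)
        have "real n powr (- \<epsilon>) \<le> real n powr 0" using n1 e by (intro powr_mono) auto
        then show "real n powr (- \<epsilon>) \<le> 1" using n1 by simp
      qed (use A w in auto)
      then show "?x / ?D \<le> A * 1 * ?w" using first[OF mn] by linarith
    qed (use D c in auto)
    also have "\<dots> = (B + A / c) * real n powr (- p) * ?w"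
      by (simp add: algebra_simps)
    finally show ?thesis .
  qed
  have sum_le: "(\<Sum>m\<in>F. f m) \<le> (A + B + A / c) * Z * r"
    if F: "finite F" "F \<subseteq> {1..} - {n}" and n: "n > N\<^sub>0" and A': "0 \<le> A'" "A' \<le> A + B + A / c"
      and r: "0 \<le> r"
      and f: "\<And>m. m \<ge> 1 \<Longrightarrow> m \<noteq> n \<Longrightarrow>
        f m \<le> A' * r * (real m powr (- p) + \<bar>real m - real n\<bar> powr (- p))"
    for F f n A' r
  proof -
    have "(\<Sum>m\<in>F. f m) \<le> (\<Sum>m\<in>F. A' * r * (real m powr (- p) + \<bar>real m - real n\<bar> powr (- p)))"
      using F f by (intro sum_mono) auto
    also have "\<dots> = A' * r * (\<Sum>m\<in>F. (real m powr (- p) + \<bar>real m - real n\<bar> powr (- p)))"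
      by (simp add: sum_distrib_left)
    also have "\<dots> \<le> (A + B + A / c) * r * Z"
      using A' r Z(2)[OF F] by (intro mult_mono) (auto intro!: sum_nonneg)
    finally show ?thesis by (simp add: mult_ac)
  qed
  show ?thesis
  proof (rule that[of "(A + B + A / c) * Z" \<epsilon> p])
    show "(A + B + A / c) * Z > 0" using A B c(1) Z(1) by (simp add: add_pos_pos)
    show "p \<le> 2 * (2 * \<alpha> + \<gamma> - 1)" using p by (simp add: \<delta>_def)
    fix n F assume nF: "n > N\<^sub>0" "finite F" "F \<subseteq> {1..} - {n}"
    have "(\<Sum>m\<in>F. real m powr (- (2 * \<alpha>)) / \<bar>\<mu> m - \<mu> n\<bar>) \<le> (A + B + A / c) * Z * real n powr (- \<epsilon>)"
      using A B c(1) first nF(1) by (intro sum_le[OF nF(2,3,1), of A]) auto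
    then show "(\<Sum>m\<in>F. real m powr (- (2 * \<alpha>)) / \<bar>\<mu> m - \<mu> n\<bar>) \<le> (A + B + A / c) * Z * real n powr (- \<epsilon>)" .
    show "(\<Sum>m\<in>F. \<mu> m / \<mu> n * (real m powr (- \<alpha>) * real n powr (- \<alpha>) / \<bar>\<mu> m - \<mu> n\<bar>)\<^sup>2)
        \<le> (A + B + A / c) * Z * real n powr (- p)"
      using A B c(1) third nF(1) by (intro sum_le[OF nF(2,3,1), of "B + A / c"]) auto
  qed (use e p in auto)
qed

section \<open>Geometry of the contours\<close>

text \<open>By the gap condition the box reaches at most half of the way to the neighbouring
  eigenvalues, and all its dimensions are of order \<open>real n powr (\<gamma> - 1)\<close>. An
  integrand of the reciprocal order therefore has an integral bounded independently of
  \<open>n\<close>.\<close>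

lemma contour_estimates:
  obtains d l where "d > 0" "l > 0"
    and "\<And>n z. n > N\<^sub>0 \<Longrightarrow> z \<in> path_image (Gamma_path \<mu> \<kappa> \<gamma> n) \<Longrightarrow>
      d * real n powr (\<gamma> - 1) \<le> cmod (z - of_real (\<mu> n))"
    and "\<And>n z k. n > N\<^sub>0 \<Longrightarrow> z \<in> path_image (Gamma_path \<mu> \<kappa> \<gamma> n) \<Longrightarrow> k \<ge> 1 \<Longrightarrow> k \<noteq> n \<Longrightarrow>
      \<bar>\<mu> k - \<mu> n\<bar> / 2 \<le> cmod (z - of_real (\<mu> k))"
    and "\<And>n f i B. n > N\<^sub>0 \<Longrightarrow> (f has_contour_integral i) (Gamma_path \<mu> \<kappa> \<gamma> n) \<Longrightarrow> 0 \<le> B \<Longrightarrow>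
      (\<forall>z\<in>path_image (Gamma_path \<mu> \<kappa> \<gamma> n). cmod (f z) \<le> B * real n powr (1 - \<gamma>)) \<Longrightarrow>
      cmod i \<le> B * l"
    and "\<And>n. n > N\<^sub>0 \<Longrightarrow>
      ((\<lambda>z. 1 / (z - of_real (\<mu> n))) has_contour_integral 2 * of_real pi * \<i>) (Gamma_path \<mu> \<kappa> \<gamma> n)"
proof -
  define r where "r = 2 powr \<bar>\<gamma> - 1\<bar>"
  have r: "r \<ge> 1" unfolding r_def by (rule ge_one_powr_ge_zero) auto
  \<comment> \<open>Half of the guaranteed gap above \<open>\<mu> n\<close>. The box extends by
    \<open>e (n - 1)\<close> to the left and by \<open>e n\<close> in the three other
    directions.\<close>
  define e where "e n = \<kappa> / 2 * real n powr (\<gamma> - 1)" for n :: nat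
  have e: "e n > 0" if "n > N\<^sub>0" for n using that kappa_pos by (simp add: e_def)
  have comp: "e n / r \<le> e (n - 1)" "e (n - 1) \<le> r * e n" "e n / r \<le> e n" "0 < e (n - 1)"
    if "n > N\<^sub>0" for n
  proof -
    \<comment> \<open>Here \<open>n \<ge> 2\<close> matters: at \<open>n = 1\<close> the value
      \<open>0 powr (\<gamma> - 1) = 0\<close> would put the left side of the box on
      \<open>\<mu> n\<close> itself.\<close>
    have n: "real (n - 1) \<ge> 1" "real n = real (n - 1) + 1" using that N0_pos by auto
    then have "real n powr (\<gamma> - 1) \<le> r * real (n - 1) powr (\<gamma> - 1)"
        "real (n - 1) powr (\<gamma> - 1) \<le> r * real n powr (\<gamma> - 1)"
      unfolding r_def by (intro powr_comparable; linarith)+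
    from this[THEN mult_left_mono[of _ _ "\<kappa> / 2"]] show "e n / r \<le> e (n - 1)" "e (n - 1) \<le> r * e n"
      using kappa_pos r by (simp_all add: e_def field_simps)
    show "e n / r \<le> e n" using e[OF that] r by (simp add: divide_le_eq mult_le_cancel_left1)
    show "0 < e (n - 1)" using n(1) kappa_pos by (simp add: e_def)
  qed
  let ?lo = "\<lambda>n. Complex (\<mu> n - e (n - 1)) (- e n)" and ?hi = "\<lambda>n. Complex (\<mu> n + e n) (e n)"
  have G: "Gamma_path \<mu> \<kappa> \<gamma> n = rectpath (?lo n) (?hi n)" for n
    by (simp add: Gamma_path_def e_def)
  have im: "(Re z \<in> {\<mu> n - e (n - 1), \<mu> n + e n} \<or> \<bar>Im z\<bar> = e n) \<and> \<mu> n - e (n - 1) \<le> Re z \<and> Re z \<le> \<mu> n + e n"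
    if "n > N\<^sub>0" "z \<in> path_image (Gamma_path \<mu> \<kappa> \<gamma> n)" for n z
    using that(2) e[OF that(1)] comp(4)[OF that(1)]
    by (auto simp: G path_image_rectpath)
  have gap': "2 * e k \<le> \<mu> (Suc k) - \<mu> k" if "k \<ge> N\<^sub>0" for k
    using gap[OF that] by (simp add: e_def)
  have far: "e n / r \<le> cmod (z - of_real (\<mu> n))"
    if "n > N\<^sub>0" "z \<in> path_image (Gamma_path \<mu> \<kappa> \<gamma> n)" for n z
  proof -
    have "e n / r \<le> \<bar>Re (z - of_real (\<mu> n))\<bar> \<or> e n / r \<le> \<bar>Im (z - of_real (\<mu> n))\<bar>"
      using im[OF that] comp[OF that(1)] by auto
    then show ?thesis
      using abs_Re_le_cmod[of "z - of_real (\<mu> n)"] abs_Im_le_cmod[of "z - of_real (\<mu> n)"] by linarith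
  qed
  show ?thesis
  \<comment> \<open>The perimeter is \<open>2 * e (n - 1) + 6 * e n\<close>, hence at most
    \<open>2 * (r + 3) * e n\<close>; this is where \<open>l\<close> comes from.\<close>
  proof (rule that[of "\<kappa> / (2 * r)" "\<kappa> * (r + 3)"])
    show "\<kappa> / (2 * r) > 0" "\<kappa> * (r + 3) > 0" using kappa_pos r by auto
  next
    fix n z assume "n > N\<^sub>0" "z \<in> path_image (Gamma_path \<mu> \<kappa> \<gamma> n)"
    from far[OF this] show "\<kappa> / (2 * r) * real n powr (\<gamma> - 1) \<le> cmod (z - of_real (\<mu> n))"
      by (simp add: e_def)
  next
    fix n z k assume n: "n > N\<^sub>0" and z: "z \<in> path_image (Gamma_path \<mu> \<kappa> \<gamma> n)" and k: "k \<ge> (1::nat)" "k \<noteq> n"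
    have "\<bar>\<mu> k - \<mu> n\<bar> / 2 \<le> \<bar>Re (z - of_real (\<mu> k))\<bar>"
    proof (cases "k < n")
      case True
      then have "\<mu> k \<le> \<mu> (n - 1)" using k by (intro mu_mono_le) auto
      moreover have "2 * e (n - 1) \<le> \<mu> n - \<mu> (n - 1)" using gap'[of "n - 1"] n by auto
      moreover have "\<mu> n - e (n - 1) \<le> Re z" using im[OF n z] by blast
      ultimately show ?thesis using comp(4)[OF n] by (simp add: abs_if)
    next
      case False
      then have "\<mu> (Suc n) \<le> \<mu> k" using k by (intro mu_mono_le) auto
      moreover have "2 * e n \<le> \<mu> (Suc n) - \<mu> n" using gap'[of n] n by auto
      moreover have "Re z \<le> \<mu> n + e n" using im[OF n z] by blast
      ultimately show ?thesis using e[OF n] by (simp add: abs_if)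
    qed
    then show "\<bar>\<mu> k - \<mu> n\<bar> / 2 \<le> cmod (z - of_real (\<mu> k))"
      using abs_Re_le_cmod order_trans by blast
  next
    fix n f i B
    assume n: "n > N\<^sub>0" and f: "(f has_contour_integral i) (Gamma_path \<mu> \<kappa> \<gamma> n)" and B: "(0::real) \<le> B"
      and le: "\<forall>z\<in>path_image (Gamma_path \<mu> \<kappa> \<gamma> n). cmod (f z) \<le> B * real n powr (1 - \<gamma>)"
    have "cmod i = cmod (contour_integral (rectpath (?lo n) (?hi n)) f)"
      using contour_integral_unique[OF f] by (simp add: G)
    also have "\<dots> \<le> B * real n powr (1 - \<gamma>)
        * (2 * \<bar>Re (?hi n - ?lo n)\<bar> + 2 * \<bar>Im (?hi n - ?lo n)\<bar>)"
      using f B le by (intro contour_integral_bound_rectpath) (auto simp: G contour_integrable_on_def)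
    also have "\<dots> \<le> B * real n powr (1 - \<gamma>) * (2 * (r + 3) * e n)"
      using B comp[OF n] e[OF n] by (intro mult_left_mono) (auto simp: algebra_simps)
    also have "\<dots> = B * (\<kappa> * (r + 3)) * (real n powr (1 - \<gamma>) * real n powr (\<gamma> - 1))"
      by (simp add: e_def)
    also have "real n powr (1 - \<gamma>) * real n powr (\<gamma> - 1) = 1"
      using n by (simp add: powr_add[symmetric])
    finally show "cmod i \<le> B * (\<kappa> * (r + 3))" by simp
  next
    fix n assume n: "n > N\<^sub>0"
    have v: "valid_path (Gamma_path \<mu> \<kappa> \<gamma> n)" by (simp add: G)
    have z: "of_real (\<mu> n) \<notin> path_image (Gamma_path \<mu> \<kappa> \<gamma> n)"
    proof
      assume "of_real (\<mu> n) \<in> path_image (Gamma_path \<mu> \<kappa> \<gamma> n)"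
      from far[OF n this] have "e n / r \<le> 0" by simp
      then show False using e[OF n] r by (simp add: divide_le_0_iff)
    qed
    have "of_real (\<mu> n) \<in> box (?lo n) (?hi n)"
      using e[OF n] comp(4)[OF n] by (simp add: in_box_complex_iff)
    then have "winding_number (Gamma_path \<mu> \<kappa> \<gamma> n) (of_real (\<mu> n)) = 1"
      unfolding G by (rule winding_number_rectpath)
    then have "contour_integral (Gamma_path \<mu> \<kappa> \<gamma> n) (\<lambda>z. 1 / (z - of_real (\<mu> n))) = 2 * of_real pi * \<i>"
      using winding_number_valid_path[OF v z] by (simp add: field_simps)
    then show "((\<lambda>z. 1 / (z - of_real (\<mu> n))) has_contour_integral 2 * of_real pi * \<i>) (Gamma_path \<mu> \<kappa> \<gamma> n)"
      using has_contour_integral_integral[OF contour_integrable_inversediff[OF v z]] by simp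
  qed
qed

section \<open>Coefficients of the Riesz vectors\<close>

text \<open>Subtracting \<open>1 / (z - \<mu> n)\<close>, whose contour integral is that of the
  unperturbed resolvent coefficient, isolates the contribution of \<open>b\<close>. It carries two
  reciprocal distances. The one to \<open>\<mu> n\<close> is balanced by the length of the contour;
  the other gives \<open>real n powr (1 - \<gamma>)\<close> on the diagonal and the reciprocal of
  \<open>\<bar>\<mu> m - \<mu> n\<bar>\<close> off it.\<close>

lemma Riesz_vector_coefficients:
  obtains N\<^sub>1 K where "N\<^sub>1 \<ge> N\<^sub>0" "K > 0"
    and "\<And>n T. n > N\<^sub>1 \<Longrightarrow> T = form_op V (\<lambda>u v. a u v + b u v) \<Longrightarrow>
      path_image (Gamma_path \<mu> \<kappa> \<gamma> n) \<subseteq> resolvent_set T \<Longrightarrow>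
      Riesz_vector T (Gamma_path \<mu> \<kappa> \<gamma> n) (\<psi> n) \<noteq> 0 \<Longrightarrow>
      cmod (cinner (Riesz_vector T (Gamma_path \<mu> \<kappa> \<gamma> n) (\<psi> n)) (\<psi> n) - 1)
        \<le> K * real n powr (- (2 * \<alpha> + \<gamma> - 1))"
    and "\<And>n T m. n > N\<^sub>1 \<Longrightarrow> T = form_op V (\<lambda>u v. a u v + b u v) \<Longrightarrow>
      path_image (Gamma_path \<mu> \<kappa> \<gamma> n) \<subseteq> resolvent_set T \<Longrightarrow>
      Riesz_vector T (Gamma_path \<mu> \<kappa> \<gamma> n) (\<psi> n) \<noteq> 0 \<Longrightarrow> m \<ge> 1 \<Longrightarrow> m \<noteq> n \<Longrightarrow>
      cmod (cinner (Riesz_vector T (Gamma_path \<mu> \<kappa> \<gamma> n) (\<psi> n)) (\<psi> m))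
        \<le> K * (real m powr (- \<alpha>) * real n powr (- \<alpha>) / \<bar>\<mu> m - \<mu> n\<bar>)"
proof -
  obtain c where c: "c > 0" "\<And>m n. m \<ge> 1 \<Longrightarrow> m \<noteq> n \<Longrightarrow> n > N\<^sub>0 \<Longrightarrow>
      c * \<bar>real m - real n\<bar> * max (real m) (real n) powr (\<gamma> - 1) \<le> \<bar>\<mu> m - \<mu> n\<bar>"
    by (rule gap_lower_bound) (rule that)
  have Delta: "0 < \<bar>\<mu> m - \<mu> n\<bar>" if "m \<ge> 1" "m \<noteq> n" "n > N\<^sub>0" for m n
  proof -
    have "0 < c * \<bar>real m - real n\<bar> * max (real m) (real n) powr (\<gamma> - 1)"
      using c(1) that by (intro mult_pos_pos) auto
    then show ?thesis using c(2)[OF that] by linarith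
  qed
  obtain C \<epsilon> where C: "C > 0" "\<epsilon> > 0"
    "\<And>n F. n > N\<^sub>0 \<Longrightarrow> finite F \<Longrightarrow> F \<subseteq> {1..} - {n} \<Longrightarrow>
      (\<Sum>m\<in>F. real m powr (- (2 * \<alpha>)) / \<bar>\<mu> m - \<mu> n\<bar>) \<le> C * real n powr (- \<epsilon>)"
    by (rule kernel_sum_bounds) (rule that)
  obtain d l where d: "d > 0" and l: "l > 0"
    and near: "\<And>n z. n > N\<^sub>0 \<Longrightarrow> z \<in> path_image (Gamma_path \<mu> \<kappa> \<gamma> n) \<Longrightarrow>
      d * real n powr (\<gamma> - 1) \<le> cmod (z - of_real (\<mu> n))"
    and far: "\<And>n z k. n > N\<^sub>0 \<Longrightarrow> z \<in> path_image (Gamma_path \<mu> \<kappa> \<gamma> n) \<Longrightarrow> k \<ge> 1 \<Longrightarrow> k \<noteq> n \<Longrightarrow>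
      \<bar>\<mu> k - \<mu> n\<bar> / 2 \<le> cmod (z - of_real (\<mu> k))"
    and int: "\<And>n f i B. n > N\<^sub>0 \<Longrightarrow> (f has_contour_integral i) (Gamma_path \<mu> \<kappa> \<gamma> n) \<Longrightarrow> 0 \<le> B \<Longrightarrow>
      (\<forall>z\<in>path_image (Gamma_path \<mu> \<kappa> \<gamma> n). cmod (f z) \<le> B * real n powr (1 - \<gamma>)) \<Longrightarrow>
      cmod i \<le> B * l"
    and wind: "\<And>n. n > N\<^sub>0 \<Longrightarrow>
      ((\<lambda>z. 1 / (z - of_real (\<mu> n))) has_contour_integral 2 * of_real pi * \<i>) (Gamma_path \<mu> \<kappa> \<gamma> n)"
    by (rule contour_estimates) (rule that)
  \<comment> \<open>The first summand bounds the terms \<open>k \<noteq> n\<close>, with a factor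
    \<open>2\<close> from the half in \<open>far\<close>; the second bounds the term
    \<open>k = n\<close> through \<open>near\<close>.\<close>
  let ?\<tau> = "\<lambda>n. 2 * M * (C * real n powr (- \<epsilon>)) + M / d * real n powr (- (2 * \<alpha> + \<gamma> - 1))"
  have sq: "(r powr (- \<alpha>))\<^sup>2 = r powr (- (2 * \<alpha>))" for r :: real
    by (simp add: power2_eq_square powr_add[symmetric])
  have zpos: "0 < cmod (z - of_real (\<mu> k))"
    if "n > N\<^sub>0" "z \<in> path_image (Gamma_path \<mu> \<kappa> \<gamma> n)" "k \<ge> 1" for n z k
  proof (cases "k = n")
    case True
    have "0 < d * real n powr (\<gamma> - 1)" using d that(1) by simp
    then have "0 < cmod (z - of_real (\<mu> n))" using near[OF that(1,2)] by linarith
    then show ?thesis by (simp only: True)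
  next
    case False
    have "0 < \<bar>\<mu> k - \<mu> n\<bar> / 2" using Delta[OF that(3) False that(1)] by simp
    then show ?thesis using far[OF that False] by (rule less_le_trans)
  qed
  have inv_near: "1 / cmod (z - of_real (\<mu> n)) \<le> real n powr (1 - \<gamma>) / d"
    if "n > N\<^sub>0" "z \<in> path_image (Gamma_path \<mu> \<kappa> \<gamma> n)" for n z
  proof -
    have n: "real n > 0" "n \<ge> 1" using that by auto
    have "1 / cmod (z - of_real (\<mu> n)) \<le> 1 / (d * real n powr (\<gamma> - 1))"
      using near[OF that] zpos[OF that n(2)] d n by (intro divide_left_mono mult_pos_pos) auto
    also have "\<dots> = real n powr (1 - \<gamma>) / d"
      using powr_minus_divide[of "real n" "\<gamma> - 1"] by simp
    finally show ?thesis .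
  qed
  have sum_tau: "(\<Sum>k\<in>F. M * (real k powr (- \<alpha>))\<^sup>2 / cmod (z - of_real (\<mu> k))) \<le> ?\<tau> n"
    if n: "n > N\<^sub>0" and z: "z \<in> path_image (Gamma_path \<mu> \<kappa> \<gamma> n)" and F: "finite F" "F \<subseteq> {1..}" for n z F
  proof -
    let ?g = "\<lambda>k. M * (real k powr (- \<alpha>))\<^sup>2 / cmod (z - of_real (\<mu> k))"
    have "(\<Sum>k\<in>F - {n}. ?g k) \<le> (\<Sum>k\<in>F - {n}. 2 * M * (real k powr (- (2 * \<alpha>)) / \<bar>\<mu> k - \<mu> n\<bar>))"
    proof (rule sum_mono)
      fix k assume "k \<in> F - {n}"
      then have k: "k \<ge> 1" "k \<noteq> n" using F by auto
      have "?g k \<le> M * (real k powr (- \<alpha>))\<^sup>2 / (\<bar>\<mu> k - \<mu> n\<bar> / 2)"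
        using M_pos far[OF n z k] Delta[OF k n] zpos[OF n z k(1)]
        by (intro divide_left_mono mult_pos_pos mult_nonneg_nonneg) auto
      then show "?g k \<le> 2 * M * (real k powr (- (2 * \<alpha>)) / \<bar>\<mu> k - \<mu> n\<bar>)"
        by (simp add: sq mult_ac)
    qed
    also have "\<dots> = 2 * M * (\<Sum>k\<in>F - {n}. real k powr (- (2 * \<alpha>)) / \<bar>\<mu> k - \<mu> n\<bar>)"
      by (simp add: sum_distrib_left)
    also have "\<dots> \<le> 2 * M * (C * real n powr (- \<epsilon>))"
      using M_pos F by (intro mult_left_mono C(3)[OF n]) auto
    finally have 1: "(\<Sum>k\<in>F - {n}. ?g k) \<le> 2 * M * (C * real n powr (- \<epsilon>))" .
    have "?g n = M * real n powr (- (2 * \<alpha>)) * (1 / cmod (z - of_real (\<mu> n)))" by (simp add: sq)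
    also have "\<dots> \<le> M * real n powr (- (2 * \<alpha>)) * (real n powr (1 - \<gamma>) / d)"
      using M_pos by (intro mult_left_mono inv_near n z) auto
    also have "\<dots> = M / d * (real n powr (- (2 * \<alpha>)) * real n powr (1 - \<gamma>))" by simp
    also have "real n powr (- (2 * \<alpha>)) * real n powr (1 - \<gamma>) = real n powr (- (2 * \<alpha> + \<gamma> - 1))"
      by (simp only: powr_add[symmetric], rule arg_cong[where f = "(powr) (real n)"]) simp
    finally have 2: "?g n \<le> M / d * real n powr (- (2 * \<alpha> + \<gamma> - 1))" .
    have "0 \<le> ?g n" using M_pos by simp
    then have "sum ?g F \<le> sum ?g (F - {n}) + ?g n"
      using F by (cases "n \<in> F") (simp_all add: sum.remove[of F n])
    then show ?thesis using 1 2 by linarith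
  qed
  \<comment> \<open>Both exponents in \<open>?\<tau>\<close> are negative, so beyond some
    \<open>N'\<close> the sum is small enough for \<open>self_bounding_weighted_sum\<close>.\<close>
  have "?\<tau> \<longlonglongrightarrow> 2 * M * (C * 0) + M / d * 0"
    using C(2) exponents
    by (intro tendsto_intros tendsto_neg_powr filterlim_real_sequentially) auto
  then have "\<forall>\<^sub>F n in sequentially. ?\<tau> n < 1 / 2"
    by (rule order_tendstoD) simp
  then obtain N' where N': "\<And>n. n \<ge> N' \<Longrightarrow> ?\<tau> n < 1 / 2"
    unfolding eventually_sequentially by blast
  have coeff: "cmod (cinner (resolvent T z (\<psi> n)) (\<psi> m) - (if m = n then 1 / (z - of_real (\<mu> n)) else 0))
      \<le> M * real m powr (- \<alpha>) * (2 * real n powr (- \<alpha>) / cmod (z - of_real (\<mu> n))) / cmod (z - of_real (\<mu> m))"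
    if n: "n > max N\<^sub>0 N'" and T: "T = form_op V (\<lambda>u v. a u v + b u v)"
      and z: "z \<in> path_image (Gamma_path \<mu> \<kappa> \<gamma> n)" "z \<in> resolvent_set T" and m: "m \<ge> 1" for n T z m
  proof -
    have nN: "n > N\<^sub>0" "n \<ge> 1" using n by auto
    let ?u = "resolvent T z (\<psi> n)"
    have u: "(?u, z *\<^sub>C ?u - \<psi> n) \<in> form_op V (\<lambda>u v. a u v + b u v)"
      using resolvent_graph[OF z(2)] unfolding T .
    then have uV: "?u \<in> V" by (simp add: form_op_def)
    define s where "s = infsum (\<lambda>k. cmod (cinner ?u (\<psi> k)) * real k powr (- \<alpha>)) {1..}"
    have eq: "(z - of_real (\<mu> k)) * cinner ?u (\<psi> k) = (if k = n then 1 else 0) + b ?u (\<psi> k)" if "k \<ge> 1" for k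
      using resolvent_equation_coefficient[OF u that] orthonormal_basis_cinner[OF basis nN(2) that] by auto
    have bs: "cmod (b ?u (\<psi> k)) \<le> M * real k powr (- \<alpha>) * s" if "k \<ge> 1" for k
      unfolding s_def by (rule b_weighted_bound[OF uV that])
    have "s \<le> 2 * real n powr (- \<alpha>) / cmod (z - of_real (\<mu> n))"
    proof (rule self_bounding_weighted_sum[where U = "\<lambda>k. cmod (cinner ?u (\<psi> k))" and M = M
          and D = "\<lambda>k. cmod (z - of_real (\<mu> k))" and w = "\<lambda>k. real k powr (- \<alpha>)"])
      fix k :: nat assume k: "k \<ge> 1"
      show "0 < cmod (z - of_real (\<mu> k))" by (rule zpos[OF nN(1) z(1) k])
      have "cmod (cinner ?u (\<psi> k)) * cmod (z - of_real (\<mu> k)) = cmod ((if k = n then 1 else 0) + b ?u (\<psi> k))"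
        by (simp only: eq[OF k, symmetric] norm_mult mult.commute)
      also have "\<dots> \<le> (if k = n then 1 else 0) + cmod (b ?u (\<psi> k))"
        using norm_triangle_ineq[of 1 "b ?u (\<psi> k)"] by auto
      finally show "cmod (cinner ?u (\<psi> k)) * cmod (z - of_real (\<mu> k))
          \<le> (if k = n then 1 else 0) + M * real k powr (- \<alpha>) * s"
        using bs[OF k] by linarith
    next
      fix F :: "nat set" assume F: "finite F" "F \<subseteq> {1..}"
      show "(\<Sum>k\<in>F. M * (real k powr (- \<alpha>))\<^sup>2 / cmod (z - of_real (\<mu> k))) \<le> 1 / 2"
        using order_trans[OF sum_tau[OF nN(1) z(1) F] less_imp_le[OF N']] n by simp
    qed (use nN s_def weighted_coefficients_summable[OF uV] in auto)
    then have "M * real m powr (- \<alpha>) * s \<le> M * real m powr (- \<alpha>) * (2 * real n powr (- \<alpha>) / cmod (z - of_real (\<mu> n)))"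
      using M_pos by (intro mult_left_mono) auto
    then have le: "cmod (b ?u (\<psi> m)) \<le> M * real m powr (- \<alpha>) * (2 * real n powr (- \<alpha>) / cmod (z - of_real (\<mu> n)))"
      using bs[OF m] by linarith
    have zm: "0 < cmod (z - of_real (\<mu> m))" by (rule zpos[OF nN(1) z(1) m])
    then have "cinner ?u (\<psi> m) - (if m = n then 1 / (z - of_real (\<mu> n)) else 0) = b ?u (\<psi> m) / (z - of_real (\<mu> m))"
      using eq[OF m] by (auto simp: field_simps)
    then show ?thesis using divide_right_mono[OF le] by (simp only: norm_divide norm_ge_zero)
  qed
  \<comment> \<open>One summand serves the diagonal coefficient, the other the off-diagonal ones.
    The factor \<open>1 / (2 * pi)\<close> of the Riesz integral is simply estimated by
    \<open>1\<close>, in \<open>ml\<close>.\<close>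
  define K where "K = l * (2 * M / (d * d) + 4 * M / d)"
  have ml: "\<And>x y. \<lbrakk>x \<le> y; 0 \<le> x\<rbrakk> \<Longrightarrow> x / (2 * pi) \<le> (y::real)"
  proof -
    fix x y :: real assume "x \<le> y" "0 \<le> x"
    then have "x / (2 * pi) \<le> x / 1" using pi_gt3 by (intro divide_left_mono) auto
    with \<open>x \<le> y\<close> show "x / (2 * pi) \<le> y" by simp
  qed
  show ?thesis
  proof (rule that[of "max N\<^sub>0 N'" K])
    show "K > 0" using l M_pos d by (simp add: K_def add_pos_pos)
  next
    fix n T
    assume n: "n > max N\<^sub>0 N'" and T: "T = form_op V (\<lambda>u v. a u v + b u v)"
      and res: "path_image (Gamma_path \<mu> \<kappa> \<gamma> n) \<subseteq> resolvent_set T"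
      and nz: "Riesz_vector T (Gamma_path \<mu> \<kappa> \<gamma> n) (\<psi> n) \<noteq> 0"
    let ?x = "cinner (Riesz_vector T (Gamma_path \<mu> \<kappa> \<gamma> n) (\<psi> n)) (\<psi> n)"
    let ?B = "2 * M / (d * d) * real n powr (- (2 * \<alpha> + \<gamma> - 1))"
    have nN: "n > N\<^sub>0" "n \<ge> 1" using n by auto
    have "cmod (2 * of_real pi * \<i> * ?x - 2 * of_real pi * \<i>) \<le> ?B * l"
    proof (rule int[OF nN(1) has_contour_integral_diff[OF cinner_Riesz_vector[OF nz] wind[OF nN(1)]]]; (rule ballI)?)
      fix z assume z: "z \<in> path_image (Gamma_path \<mu> \<kappa> \<gamma> n)"
      have "cmod (cinner (resolvent T z (\<psi> n)) (\<psi> n) - 1 / (z - of_real (\<mu> n)))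
        \<le> 2 * M * real n powr (- (2 * \<alpha>)) * (1 / cmod (z - of_real (\<mu> n)) * (1 / cmod (z - of_real (\<mu> n))))"
        using coeff[OF n T z subsetD[OF res z] nN(2)]
        unfolding sq[symmetric] power2_eq_square by (simp add: mult_ac)
      also have "\<dots> \<le> 2 * M * real n powr (- (2 * \<alpha>)) * ((real n powr (1 - \<gamma>) / d) * (real n powr (1 - \<gamma>) / d))"
        using M_pos inv_near[OF nN(1) z] d by (intro mult_left_mono mult_mono) auto
      also have "\<dots> = 2 * M / (d * d) * (real n powr (- (2 * \<alpha>)) * real n powr (1 - \<gamma>)) * real n powr (1 - \<gamma>)"
        by simp
      also have "real n powr (- (2 * \<alpha>)) * real n powr (1 - \<gamma>) = real n powr (- (2 * \<alpha> + \<gamma> - 1))"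
        by (simp only: powr_add[symmetric], rule arg_cong[where f = "(powr) (real n)"]) simp
      finally show "cmod (cinner (resolvent T z (\<psi> n)) (\<psi> n) - 1 / (z - of_real (\<mu> n))) \<le> ?B * real n powr (1 - \<gamma>)" .
    qed (use M_pos d in simp)
    moreover have "cmod (2 * of_real pi * \<i> * ?x - 2 * of_real pi * \<i>) = 2 * pi * cmod (?x - 1)"
    proof -
      have "2 * of_real pi * \<i> * ?x - 2 * of_real pi * \<i> = 2 * of_real pi * \<i> * (?x - 1)"
        by (simp add: right_diff_distrib)
      then show ?thesis by (simp only: norm_mult) simp
    qed
    ultimately have "2 * pi * cmod (?x - 1) / (2 * pi) \<le> ?B * l" by (intro ml) auto
    also have "\<dots> \<le> K * real n powr (- (2 * \<alpha> + \<gamma> - 1))"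
    proof -
      have "2 * M / (d * d) * l \<le> K" using l M_pos d by (simp add: K_def algebra_simps)
      then have "2 * M / (d * d) * l * real n powr (- (2 * \<alpha> + \<gamma> - 1)) \<le> K * real n powr (- (2 * \<alpha> + \<gamma> - 1))"
        by (intro mult_right_mono) auto
      then show ?thesis by (simp add: mult_ac)
    qed
    finally show "cmod (?x - 1) \<le> K * real n powr (- (2 * \<alpha> + \<gamma> - 1))" by simp
  next
    fix n T m
    assume n: "n > max N\<^sub>0 N'" and T: "T = form_op V (\<lambda>u v. a u v + b u v)"
      and res: "path_image (Gamma_path \<mu> \<kappa> \<gamma> n) \<subseteq> resolvent_set T"
      and nz: "Riesz_vector T (Gamma_path \<mu> \<kappa> \<gamma> n) (\<psi> n) \<noteq> 0" and m: "m \<ge> (1::nat)" "m \<noteq> n"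
    let ?x = "cinner (Riesz_vector T (Gamma_path \<mu> \<kappa> \<gamma> n) (\<psi> n)) (\<psi> m)"
    let ?w = "real m powr (- \<alpha>) * real n powr (- \<alpha>) / \<bar>\<mu> m - \<mu> n\<bar>"
    have nN: "n > N\<^sub>0" "n \<ge> 1" using n by auto
    have "cmod (2 * of_real pi * \<i> * ?x) \<le> (4 * M / d * ?w) * l"
    proof (rule int[OF nN(1) cinner_Riesz_vector[OF nz]]; (rule ballI)?)
      fix z assume z: "z \<in> path_image (Gamma_path \<mu> \<kappa> \<gamma> n)"
      have "cmod (cinner (resolvent T z (\<psi> n)) (\<psi> m))
        \<le> 2 * M * (real m powr (- \<alpha>) * real n powr (- \<alpha>)) * (1 / cmod (z - of_real (\<mu> n)) * (1 / cmod (z - of_real (\<mu> m))))"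
        using coeff[OF n T z subsetD[OF res z] m(1)] m(2) by (simp add: mult_ac)
      also have "\<dots> \<le> 2 * M * (real m powr (- \<alpha>) * real n powr (- \<alpha>)) * ((real n powr (1 - \<gamma>) / d) * (1 / (\<bar>\<mu> m - \<mu> n\<bar> / 2)))"
        using M_pos inv_near[OF nN(1) z] d far[OF nN(1) z m] Delta[OF m nN(1)] zpos[OF nN(1) z m(1)]
        by (intro mult_left_mono mult_mono divide_left_mono mult_pos_pos) auto
      finally show "cmod (cinner (resolvent T z (\<psi> n)) (\<psi> m)) \<le> (4 * M / d * ?w) * real n powr (1 - \<gamma>)"
        by (simp add: mult_ac)
    qed (use M_pos d in simp)
    then have "2 * pi * cmod ?x / (2 * pi) \<le> (4 * M / d * ?w) * l"
      by (intro ml) (auto simp: norm_mult)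
    also have "\<dots> = (4 * M / d * l) * ?w" by (simp add: mult_ac)
    also have "\<dots> \<le> K * ?w"
      using l M_pos d by (intro mult_right_mono) (auto simp: K_def algebra_simps)
    finally show "cmod ?x \<le> K * ?w" by simp
  qed simp
qed

section \<open>Summation over all coefficients and all \<open>n\<close>\<close>

text \<open>On coefficients \<open>S\<close> acts as multiplication by
  \<open>sqrt (\<mu> k)\<close>, so the \<open>n\<close>-th term is the sum over \<open>k\<close> of
  \<open>\<mu> k / \<mu> n\<close> times the squared moduli of the coefficients of
  \<open>\<psi> n - \<phi> n\<close>. Its diagonal and off-diagonal parts are both of order
  \<open>real n powr (- p)\<close>.\<close>

lemma Riesz_vectors_quadratically_close:
  assumes T: "T = form_op V (\<lambda>u v. a u v + b u v)"
    and res: "\<And>n. n > N \<Longrightarrow> path_image (Gamma_path \<mu> \<kappa> \<gamma> n) \<subseteq> resolvent_set T"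
    and phi: "\<And>n. n > N \<Longrightarrow> \<phi> n = Riesz_vector T (Gamma_path \<mu> \<kappa> \<gamma> n) (\<psi> n)"
    and phi_V: "\<And>n. n > N \<Longrightarrow> \<phi> n \<noteq> 0 \<and> \<phi> n \<in> V"
  shows "(\<lambda>n. (norm (\<mu> n powr (- 1 / 2) *\<^sub>R op_app S (\<psi> n) -
                     \<mu> n powr (- 1 / 2) *\<^sub>R op_app S (\<phi> n)))\<^sup>2) summable_on {1..}"
    (is "?f summable_on _")
proof -
  obtain N\<^sub>1 K where N1: "N\<^sub>1 \<ge> N\<^sub>0" and K: "K > 0"
    and diag: "\<And>n T. n > N\<^sub>1 \<Longrightarrow> T = form_op V (\<lambda>u v. a u v + b u v) \<Longrightarrow>
      path_image (Gamma_path \<mu> \<kappa> \<gamma> n) \<subseteq> resolvent_set T \<Longrightarrow>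
      Riesz_vector T (Gamma_path \<mu> \<kappa> \<gamma> n) (\<psi> n) \<noteq> 0 \<Longrightarrow>
      cmod (cinner (Riesz_vector T (Gamma_path \<mu> \<kappa> \<gamma> n) (\<psi> n)) (\<psi> n) - 1)
        \<le> K * real n powr (- (2 * \<alpha> + \<gamma> - 1))"
    and off: "\<And>n T m. n > N\<^sub>1 \<Longrightarrow> T = form_op V (\<lambda>u v. a u v + b u v) \<Longrightarrow>
      path_image (Gamma_path \<mu> \<kappa> \<gamma> n) \<subseteq> resolvent_set T \<Longrightarrow>
      Riesz_vector T (Gamma_path \<mu> \<kappa> \<gamma> n) (\<psi> n) \<noteq> 0 \<Longrightarrow> m \<ge> 1 \<Longrightarrow> m \<noteq> n \<Longrightarrow>
      cmod (cinner (Riesz_vector T (Gamma_path \<mu> \<kappa> \<gamma> n) (\<psi> n)) (\<psi> m))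
        \<le> K * (real m powr (- \<alpha>) * real n powr (- \<alpha>) / \<bar>\<mu> m - \<mu> n\<bar>)"
    by (rule Riesz_vector_coefficients) (rule that)
  obtain C p where C: "C > 0" and p: "p > 1" "p \<le> 2 * (2 * \<alpha> + \<gamma> - 1)"
    and sums: "\<And>n F. n > N\<^sub>0 \<Longrightarrow> finite F \<Longrightarrow> F \<subseteq> {1..} - {n} \<Longrightarrow>
      (\<Sum>m\<in>F. \<mu> m / \<mu> n * (real m powr (- \<alpha>) * real n powr (- \<alpha>) / \<bar>\<mu> m - \<mu> n\<bar>)\<^sup>2)
        \<le> C * real n powr (- p)"
    by (rule kernel_sum_bounds) (rule that)
  have le: "?f n \<le> K\<^sup>2 * (1 + C) * real n powr (- p)" if n: "n > max N N\<^sub>1" for n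
  proof -
    have nN: "n > N" "n > N\<^sub>1" "n > N\<^sub>0" "n \<ge> 1" using n N1 by auto
    have mu: "\<mu> n > 0" by (rule mu_pos[OF nN(4)])
    let ?w = "\<mu> n powr (- 1 / 2) *\<^sub>R op_app S (\<psi> n) - \<mu> n powr (- 1 / 2) *\<^sub>R op_app S (\<phi> n)"
    let ?x = "\<lambda>k. (if k = n then 1 else 0) - cinner (\<phi> n) (\<psi> k)"
    have nz: "Riesz_vector T (Gamma_path \<mu> \<kappa> \<gamma> n) (\<psi> n) \<noteq> 0"
      using phi[OF nN(1)] phi_V[OF nN(1)] by simp
    have xn: "cmod (?x n) \<le> K * real n powr (- (2 * \<alpha> + \<gamma> - 1))"
      using diag[OF nN(2) T res[OF nN(1)] nz] by (simp add: phi[OF nN(1)] norm_minus_commute)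
    have xk: "cmod (?x k) \<le> K * (real k powr (- \<alpha>) * real n powr (- \<alpha>) / \<bar>\<mu> k - \<mu> n\<bar>)" if "k \<ge> 1" "k \<noteq> n" for k
      using off[OF nN(2) T res[OF nN(1)] nz that] that(2) by (simp add: phi[OF nN(1)])
    have wk: "(cmod (cinner ?w (\<psi> k)))\<^sup>2 = \<mu> k / \<mu> n * (cmod (?x k))\<^sup>2" if k: "k \<ge> 1" for k
    proof -
      have "cinner ?w (\<psi> k) = of_real (\<mu> n powr (- 1 / 2) * sqrt (\<mu> k)) * ?x k"
        using S_expansion(1)[OF psi_in_V[OF nN(4)] k] S_expansion(1)[of "\<phi> n" k] phi_V[OF nN(1)] k
          orthonormal_basis_cinner[OF basis nN(4) k]
        by (auto simp: cinner_diff_left scaleR_scaleC cinner_scaleC_left algebra_simps)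
      then have "(cmod (cinner ?w (\<psi> k)))\<^sup>2 = (\<mu> n powr (- 1 / 2))\<^sup>2 * \<mu> k * (cmod (?x k))\<^sup>2"
        using mu_pos[OF k] by (simp add: norm_mult power_mult_distrib less_imp_le)
      also have "(\<mu> n powr (- 1 / 2))\<^sup>2 = 1 / \<mu> n"
        using mu by (simp add: power2_eq_square powr_add[symmetric] powr_minus_divide)
      finally show ?thesis by simp
    qed
    show ?thesis
    proof (rule norm_le_of_coefficients[OF basis])
      fix J
      let ?g = "\<lambda>k. \<mu> k / \<mu> n * (cmod (?x k))\<^sup>2"
      have "(\<Sum>k\<in>{1..J} - {n}. ?g k)
          \<le> (\<Sum>k\<in>{1..J} - {n}. K\<^sup>2 * (\<mu> k / \<mu> n * (real k powr (- \<alpha>) * real n powr (- \<alpha>) / \<bar>\<mu> k - \<mu> n\<bar>)\<^sup>2))"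
      proof (rule sum_mono)
        fix k assume "k \<in> {1..J} - {n}"
        then have k: "k \<ge> 1" "k \<noteq> n" by auto
        have "(cmod (?x k))\<^sup>2 \<le> (K * (real k powr (- \<alpha>) * real n powr (- \<alpha>) / \<bar>\<mu> k - \<mu> n\<bar>))\<^sup>2"
          using xk[OF k] by (intro power_mono) auto
        then have "?g k \<le> \<mu> k / \<mu> n * (K * (real k powr (- \<alpha>) * real n powr (- \<alpha>) / \<bar>\<mu> k - \<mu> n\<bar>))\<^sup>2"
          using mu mu_pos[OF k(1)] by (intro mult_left_mono) auto
        then show "?g k \<le> K\<^sup>2 * (\<mu> k / \<mu> n * (real k powr (- \<alpha>) * real n powr (- \<alpha>) / \<bar>\<mu> k - \<mu> n\<bar>)\<^sup>2)"
          by (simp only: power_mult_distrib mult.left_commute)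
      qed
      also have "\<dots> = K\<^sup>2 * (\<Sum>k\<in>{1..J} - {n}. \<mu> k / \<mu> n * (real k powr (- \<alpha>) * real n powr (- \<alpha>) / \<bar>\<mu> k - \<mu> n\<bar>)\<^sup>2)"
        by (simp only: sum_distrib_left)
      also have "\<dots> \<le> K\<^sup>2 * (C * real n powr (- p))"
        by (intro mult_left_mono sums nN) auto
      finally have 1: "(\<Sum>k\<in>{1..J} - {n}. ?g k) \<le> K\<^sup>2 * (C * real n powr (- p))" .
      have "?g n = (cmod (?x n))\<^sup>2" using mu by simp
      also have "\<dots> \<le> (K * real n powr (- (2 * \<alpha> + \<gamma> - 1)))\<^sup>2"
        using xn by (intro power_mono) auto
      also have "\<dots> = K\<^sup>2 * real n powr (- (2 * (2 * \<alpha> + \<gamma> - 1)))"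
      proof -
        have "(x powr (- r))\<^sup>2 = x powr (- (2 * r))" for x r :: real
          by (simp add: power2_eq_square powr_add[symmetric])
        then show ?thesis by (simp only: power_mult_distrib)
      qed
      \<comment> \<open>The bound \<open>p \<le> 2 * (2 * \<alpha> + \<gamma> - 1)\<close> lets the
        diagonal term share the exponent of the off-diagonal sum.\<close>
      also have "\<dots> \<le> K\<^sup>2 * real n powr (- p)"
        using p nN by (intro mult_left_mono powr_mono) auto
      finally have 2: "?g n \<le> K\<^sup>2 * real n powr (- p)" .
      have "(\<Sum>k\<in>{1..J}. (cmod (cinner ?w (\<psi> k)))\<^sup>2) = sum ?g {1..J}"
        by (rule sum.cong) (use wk in auto)
      also have "\<dots> \<le> sum ?g ({1..J} - {n}) + ?g n"
      proof (cases "n \<in> {1..J}")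
        case True
        then show ?thesis using sum.remove[of "{1..J}" n ?g] by simp
      next
        case False
        then show ?thesis using mu by simp
      qed
      also have "\<dots> \<le> K\<^sup>2 * (C * real n powr (- p)) + K\<^sup>2 * real n powr (- p)"
        by (rule add_mono[OF 1 2])
      finally show "(\<Sum>k\<in>{1..J}. (cmod (cinner ?w (\<psi> k)))\<^sup>2) \<le> K\<^sup>2 * (1 + C) * real n powr (- p)"
        by (simp add: algebra_simps)
    qed
  qed
  have "summable ?f"
  proof (rule summable_comparison_test_ev)
    \<comment> \<open>The comparison is made only eventually; the finitely many earlier terms do not
      affect convergence.\<close>
    show "\<forall>\<^sub>F n in sequentially. norm (?f n) \<le> K\<^sup>2 * (1 + C) * real n powr (- p)"
      using eventually_gt_at_top[of "max N N\<^sub>1"] by eventually_elim (use le in simp)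
    show "summable (\<lambda>n. K\<^sup>2 * (1 + C) * real n powr (- p))"
      using p by (intro summable_mult) (simp add: summable_real_powr_iff)
  qed
  then have "?f summable_on UNIV"
    by (subst summable_on_UNIV_nonneg_real_iff) simp_all
  then show ?thesis by (rule summable_on_subset_banach) simp
qed

end

theorem theoremA9:
  fixes V :: "'h::chilbert_space set"
    and a b :: "'h \<Rightarrow> 'h \<Rightarrow> complex"
    and A S T :: "('h \<times> 'h) set"
    and \<mu> :: "nat \<Rightarrow> real"
    and \<psi> \<phi> :: "nat \<Rightarrow> 'h"
    and ev :: "nat \<Rightarrow> complex"
    and \<gamma> \<kappa> \<alpha> M\<^sub>b :: real
    and N\<^sub>0 N :: nat
  assumes separable: "separable_space (euclidean :: 'h topology)"
    and infinite_dimensional: "\<nexists>B :: 'h set. finite B \<and> complex_vector.span B = UNIV"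
    \<comment> \<open>the form a, the operator A and its square root S\<close>
    and a_form: "sesquilinear_on V a" "closure V = UNIV" "hermitian_on V a"
      "positive_definite_on V a" "closed_form V a"
    and A_def: "A = form_op V a"
    and S_sqrt: "is_sqrt_op S A"
    and A_compact_resolvent: "has_compact_resolvent A"
    and psi_basis: "orthonormal_basis \<psi>"
    and psi_eigen: "\<And>k. k \<ge> 1 \<Longrightarrow> (\<psi> k, complex_of_real (\<mu> k) *\<^sub>C \<psi> k) \<in> A"
    and mu_pos: "0 < \<mu> 1"
    and mu_mono: "\<And>k. k \<ge> 1 \<Longrightarrow> \<mu> k \<le> \<mu> (k + 1)"
    \<comment> \<open>the perturbation b\<close>
    and b_form: "sesquilinear_on V b"
    and b_continuous:
      "\<exists>C. \<forall>u\<in>V. \<forall>v\<in>V. cmod (b u v) \<le> C * norm (op_app S u) * norm (op_app S v)"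
    \<comment> \<open>standing assumptions\<close>
    and constants_pos: "\<gamma> > 0" "\<kappa> > 0" "N\<^sub>0 > 0" "M\<^sub>b > 0"
    and gap: "\<And>k. k \<ge> N\<^sub>0 \<Longrightarrow> \<mu> (k + 1) - \<mu> k \<ge> \<kappa> * real k powr (\<gamma> - 1)"
    and exponents: "2 * \<alpha> + \<gamma> > 1"
    and b_bound: "\<And>m n. m \<ge> 1 \<Longrightarrow> n \<ge> 1 \<Longrightarrow>
      cmod (b (\<psi> m) (\<psi> n)) \<le> M\<^sub>b * real m powr (- \<alpha>) * real n powr (- \<alpha>)"
    \<comment> \<open>the operator T, its eigenvalues in the boxes, and the root vectors\<close>
    and T_def: "T = form_op V (\<lambda>u v. a u v + b u v)"
    and N_pos: "N \<ge> 1"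
    and contour_resolvent:
      "\<And>n. n > N \<Longrightarrow> path_image (Gamma_path \<mu> \<kappa> \<gamma> n) \<subseteq> resolvent_set T"
    and unique_eigenvalue:
      "\<And>n. n > N \<Longrightarrow> {z \<in> Pi_box \<mu> \<kappa> \<gamma> n. is_eigenvalue T z} = {ev n}"
    and simple_eigenvalue: "\<And>n. n > N \<Longrightarrow> algebraically_simple T (ev n)"
    and phi_integral: "\<And>n. n > N \<Longrightarrow> \<phi> n = Riesz_vector T (Gamma_path \<mu> \<kappa> \<gamma> n) (\<psi> n)"
    and phi_eigenvector: "\<And>n. n > N \<Longrightarrow> \<phi> n \<noteq> 0 \<and> (\<phi> n, ev n *\<^sub>C \<phi> n) \<in> T"
    and phi_root_vectors: "\<And>n. 1 \<le> n \<Longrightarrow> n \<le> N \<Longrightarrow>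
      \<exists>z\<in>remaining_eigenvalues T (Pi_box \<mu> \<kappa> \<gamma>) N. \<phi> n \<in> root_subspace T z"
    and phi_root_basis: "inj_on \<phi> {1..N}" "complex_vector.independent (\<phi> ` {1..N})"
      "complex_vector.span (\<phi> ` {1..N}) =
       complex_vector.span
         (\<Union>z\<in>remaining_eigenvalues T (Pi_box \<mu> \<kappa> \<gamma>) N. root_subspace T z)"
    \<comment> \<open>the hypothesis of the theorem\<close>
    and alpha_gamma: "if \<alpha> \<le> 1 then 2 * \<alpha> + \<gamma> > 3 / 2 else 2 * \<alpha> + \<gamma> > 1"
  shows "(\<lambda>n. (norm (\<mu> n powr (- 1 / 2) *\<^sub>R op_app S (\<psi> n) -
                     \<mu> n powr (- 1 / 2) *\<^sub>R op_app S (\<phi> n)))\<^sup>2) summable_on {1..}"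
proof -
  obtain C\<^sub>b where b_cont: "\<And>u v. u \<in> V \<Longrightarrow> v \<in> V \<Longrightarrow>
      cmod (b u v) \<le> C\<^sub>b * norm (op_app S u) * norm (op_app S v)"
    using b_continuous by blast
  have exponent: "2 * \<alpha> + \<gamma> > 3 / 2"
    using alpha_gamma constants_pos(1) by (auto split: if_splits)
  interpret form_perturbation V a b S \<mu> \<psi> \<gamma> \<kappa> \<alpha> M\<^sub>b C\<^sub>b N\<^sub>0
    using a_form S_sqrt psi_basis psi_eigen mu_pos mu_mono b_form b_cont constants_pos gap
      exponent b_bound
    by unfold_locales (simp_all only: A_def)
  \<comment> \<open>Nonvanishing feeds the integrability argument in
    \<open>cinner_Riesz_vector\<close>; membership in \<open>V\<close>, which contains the domain of
    \<open>T\<close>, gives access to \<open>S_expansion\<close>.\<close>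
  have "\<phi> n \<noteq> 0 \<and> \<phi> n \<in> V" if "n > N" for n
    using phi_eigenvector[OF that] by (simp add: T_def form_op_def)
  with contour_resolvent phi_integral show ?thesis
    by (intro Riesz_vectors_quadratically_close[OF T_def, of N \<phi>]) blast+
qed

end
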